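(* Let $w\in\mathrm{Sym}^D\mathbb{C}^m$ be a nonzero polystable form and $G=\mathrm{GL}_m$. Then $m\le e(w)$. If $D$ is odd, then this inequality is strict. Moreover, if $D$ is even, then $m=e(w)$ if and only if $P_{D,m}(w)\neq 0$. In this case, the fundamental invariant of $w$ is $$\Phi_w=P_{D,m}(w)^{-1}\,P_{D,m}\quad\text{on }\overline{Gw}.$$
   Context: Work over $\mathbb{C}$. $\mathrm{Sym}^D\mathbb{C}^m$ is the space of forms of degree $D$ in $X_1,\dots,X_m$, identified with the symmetric tensors in $\bigotimes^D\mathbb{C}^m$ (with $X_{i_1}\cdots X_{i_D}$ corresponding to $\frac1{D!}\sum_{\pi\in S_D}e_{i_{\pi(1)}}\otimes\cdots\otimes e_{i_{\pi(D)}}$), with the natural action of $G=\mathrm{GL}_m$. A form is polystable if its $\mathrm{SL}_m$-orbit is closed. $\mathcal{O}(\overline{Gw})^{\mathrm{SL}_m}_d$ denotes the space of $\mathrm{SL}_m$-invariant regular functions on the orbit closure $\overline{Gw}$ homogeneous of degree $d$; for nonzero polystable $w$ it is at most one-dimensional, and it is nonzero for some $d>0$. The minimal degree $e(w)$ is the smallest positive $d$ with $\mathcal{O}(\overline{Gw})^{\mathrm{SL}_m}_d\ne0$, and the fundamental invariant $\Phi_w$ is the unique element of $\mathcal{O}(\overline{Gw})^{\mathrm{SL}_m}_{e(w)}$ with $\Phi_w(w)=1$. For $D$ even, $P_{D,m}$ (the generic fundamental invariant) is, up to scaling, the unique nonzero homogeneous $\mathrm{SL}_m$-invariant of degree $m$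 on $\mathrm{Sym}^D\mathbb{C}^m$; explicitly, writing $v=\sum v(\nu_1,\dots,\nu_D)\,e_{\nu_1}\otimes\cdots\otimes e_{\nu_D}$, $$P_{D,m}(v)=\sum_{\sigma_1,\dots,\sigma_D\in S_m}\Big[\prod_{j=1}^D\mathrm{sgn}(\sigma_j)\Big]\prod_{i=1}^m v(\sigma_1(i),\dots,\sigma_D(i)).$$
   Formalization: The strict inequality for odd D is stated only for m ≥ 2, because for m = 1 every nonzero form cX^D is polystable with e(w) = 1 = m, so strictness fails; D ≥ 1 is assumed throughout, since degrees are not defined for D = 0. *)

theory Defs
  imports "HOL-Analysis.Analysis"
begin

text \<open>
  Tensors in the \<open>D\<close>-fold tensor power of \<open>C^m\<close> are their coordinate families with respect to
  the basis \<open>e_\<nu>(1) \<otimes> ... \<otimes> e_\<nu>(D)\<close>. The finite index types \<open>'d\<close> and \<open>'m\<close> stand for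
  \<open>{1..D}\<close> and \<open>{1..m}\<close>, so \<open>D = CARD('d) \<ge> 1\<close> and \<open>m = CARD('m) \<ge> 1\<close>.
\<close>

type_synonym ('d, 'm) tensor = "complex ^ ('d \<Rightarrow> 'm)"

text \<open>
  A form of degree \<open>D\<close> in \<open>X_1, ..., X_m\<close> is identified with the symmetric tensor obtained by
  sending a monomial \<open>X_\<nu>(1) ... X_\<nu>(D)\<close> to the average of the \<open>e_\<nu>(\<pi>(1)) \<otimes> ... \<otimes> e_\<nu>(\<pi>(D))\<close>.
\<close>

definition sym_forms :: "('d::finite, 'm::finite) tensor set" where
  "sym_forms = {v. \<forall>\<pi> \<nu>. \<pi> permutes (UNIV :: 'd set) \<longrightarrow> v $ (\<nu> \<circ> \<pi>) = v $ \<nu>}"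

text \<open>The action \<open>g (x_1 \<otimes> ... \<otimes> x_D) = g x_1 \<otimes> ... \<otimes> g x_D\<close> in coordinates.\<close>

definition tensor_act ::
  "complex^'m^'m \<Rightarrow> ('d::finite, 'm::finite) tensor \<Rightarrow> ('d, 'm) tensor" where
  "tensor_act g v = (\<chi> \<mu>. \<Sum>\<nu>\<in>UNIV. (\<Prod>j\<in>UNIV. g $ \<mu> j $ \<nu> j) * v $ \<nu>)"

definition GL :: "(complex^'m^'m) set" where
  "GL = {g. invertible g}"

definition SL :: "(complex^'m^'m) set" where
  "SL = {g. det g = 1}"

definition orbit :: 
  "(complex^'m^'m) set \<Rightarrow> ('d::finite, 'm::finite) tensor \<Rightarrow> ('d, 'm) tensor set" where
  "orbit H w = (\<lambda>g. tensor_act g w) ` H"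

text \<open>Complex polynomial functions; compare \<open>real_polynomial_function\<close> in the library.\<close>

inductive complex_polynomial_function :: "(complex^'n \<Rightarrow> complex) \<Rightarrow> bool" where
  coord: "complex_polynomial_function (\<lambda>x. x $ i)"
| const: "complex_polynomial_function (\<lambda>x. c)"
| add: "complex_polynomial_function f \<Longrightarrow> complex_polynomial_function g
    \<Longrightarrow> complex_polynomial_function (\<lambda>x. f x + g x)"
| mult: "complex_polynomial_function f \<Longrightarrow> complex_polynomial_function g
    \<Longrightarrow> complex_polynomial_function (\<lambda>x. f x * g x)"

text \<open>
  Closedness and closures are taken in the Zariski topology. They are formed in the full tensor
  space; since \<open>sym_forms\<close> is a linear subspace, hence closed, this agrees with forming them there.
\<close>

definition zariski_closed :: "(complex^'n) set \<Rightarrow> bool" where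
  "zariski_closed Z \<longleftrightarrow>
    (\<exists>F. (\<forall>p\<in>F. complex_polynomial_function p) \<and> Z = {x. \<forall>p\<in>F. p x = 0})"

definition zariski_closure :: "(complex^'n) set \<Rightarrow> (complex^'n) set" where
  "zariski_closure X = zariski_closed hull X"

definition polystable :: "('d::finite, 'm::finite) tensor \<Rightarrow> bool" where
  "polystable w \<longleftrightarrow> zariski_closed (orbit SL w)"

definition orbit_closure :: "('d::finite, 'm::finite) tensor \<Rightarrow> ('d, 'm) tensor set" where
  "orbit_closure w = zariski_closure (orbit GL w)"

text \<open>
  Regular functions on a Zariski closed set \<open>Z\<close> are the restrictions to \<open>Z\<close> of polynomial
  functions. They are represented extensionally (\<open>undefined\<close> outside \<open>Z\<close>), so equality
  of such functions is equality on \<open>Z\<close>.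
\<close>

definition regular_functions :: "(complex^'n) set \<Rightarrow> (complex^'n \<Rightarrow> complex) set" where
  "regular_functions Z = {restrict p Z |p. complex_polynomial_function p}"

text \<open>The orbit closure is a cone because \<open>D \<ge> 1\<close>, so homogeneity makes sense on it.\<close>

definition SL_invariants ::
  "('d::finite, 'm::finite) tensor \<Rightarrow> nat \<Rightarrow> (('d, 'm) tensor \<Rightarrow> complex) set" where
  "SL_invariants w d = {f \<in> regular_functions (orbit_closure w).
     (\<forall>g\<in>SL. \<forall>v\<in>orbit_closure w. f (tensor_act g v) = f v) \<and>
     (\<forall>c. \<forall>v\<in>orbit_closure w. f (c *s v) = c ^ d * f v)}"

definition min_degree :: "('d::finite, 'm::finite) tensor \<Rightarrow> nat" where
  "min_degree w =
    (LEAST d. d > 0 \<and> (\<exists>f\<in>SL_invariants w d. \<exists>v\<in>orbit_closure w. f v \<noteq> 0))"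

definition fundamental_invariant ::
  "('d::finite, 'm::finite) tensor \<Rightarrow> ('d, 'm) tensor \<Rightarrow> complex" where
  "fundamental_invariant w = (THE f. f \<in> SL_invariants w (min_degree w) \<and> f w = 1)"

definition generic_invariant :: "('d::finite, 'm::finite) tensor \<Rightarrow> complex" where
  "generic_invariant v =
    (\<Sum>\<sigma> | \<forall>j. \<sigma> j permutes (UNIV :: 'm set).
       (\<Prod>j\<in>UNIV. of_int (sign (\<sigma> j))) * (\<Prod>i\<in>UNIV. v $ (\<lambda>j. \<sigma> j i)))"

end

theory Submission
  imports Defs
begin

text \<open>
  Write \<open>D = CARD('d)\<close> and \<open>m = CARD('m)\<close>. The proof studies multilinear forms \<open>M\<close> in \<open>d\<close> tensors
  that are invariant under simultaneous action of matrices of determinant \<open>1\<close>. If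
  \<open>det g = t ^ m\<close> with \<open>t \<noteq> 0\<close>, then \<open>g / t\<close> has determinant \<open>1\<close>, and therefore
  \<open>M (g v\<^sub>1, ..., g v\<^sub>d) = t ^ (D * d) * M (v\<^sub>1, ..., v\<^sub>d)\<close> (\<open>multi_form_GL_act\<close>). Symmetric tensors are spanned
  by powers \<open>l \<otimes> ... \<otimes> l\<close> of vectors (\<open>sym_forms_span_powers\<close>), so on symmetric tensors \<open>M\<close> is determined
  by its values on powers of vectors \<open>l\<^sub>1, ..., l\<^sub>d\<close>.

  If \<open>d > 0\<close> and these vectors lie in a hyperplane, some \<open>g\<close> of determinant \<open>2\<close> fixes all of them, so
  \<open>M\<close> takes the value \<open>0\<close> (\<open>multi_form_vector_power_dependent\<close>). Hence a nonzero value at a symmetric \<open>w\<close> requires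
  \<open>d \<ge> m\<close> (\<open>invariant_form_degree_ge\<close>). If \<open>d = m\<close>, then \<open>M\<close> takes the value \<open>c * det (l\<^sub>1, ..., l\<^sub>m) ^ D\<close>,
  and the polarisation of the generic invariant takes the value \<open>det (l\<^sub>1, ..., l\<^sub>m) ^ D\<close>
  (\<open>polar_invariant_vector_power\<close>), so that \<open>M\<close> is on the diagonal a multiple of the
  generic invariant (\<open>invariant_form_degree_eq\<close>). The same formula shows that the generic invariant is
  invariant, and a sign change shows that it vanishes if \<open>D\<close> is odd and \<open>m \<ge> 2\<close>.

  The functions in the definition of the minimal degree live only on an orbit closure. That they come from
  invariant multilinear forms on the whole space is the reductivity of \<open>SL\<close>. It follows from linear algebra:
  for the standard inner product on the coefficients of polynomials of bounded degree, the adjoint of the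
  action of \<open>g\<close> is the action of the conjugate transpose of \<open>g\<close>, which again has determinant \<open>1\<close>.
  So if \<open>K\<close> is a stable subspace and \<open>a\<close> is invariant modulo \<open>K\<close>, then the component of \<open>a\<close>
  orthogonal to \<open>K\<close> is invariant (\<open>invariant_representative\<close>). Taking for \<open>K\<close> the polynomials that vanish
  on a stable set \<open>X\<close> extends invariants from \<open>X\<close> to the whole space
  (\<open>invariant_polynomial_extension\<close>). With \<open>X\<close> the orbit closure this gives the reduction to
  multilinear forms; with \<open>X\<close> the closed orbit and the origin it gives the existence of an
  invariant of positive degree that is nonzero at \<open>w\<close> (\<open>polystable_nonvanishing_form\<close>), without which
  the minimal degree would have no meaning. Finally, a homogeneous invariant on the orbit
  closure is determined by its value at \<open>w\<close> (\<open>SL_invariants_eqI\<close>), which identifies the fundamental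
  invariant.
\<close>

section \<open>Invariant vectors modulo a stable subspace\<close>

text \<open>
  Induction on \<open>S\<close>, one coordinate at a time: the members of \<open>K\<close> that vanish at the new coordinate
  \<open>a\<close> form a subspace \<open>K0\<close> on which \<open>a\<close> does not contribute to the inner product, and \<open>K\<close> is \<open>K0\<close>
  plus at most one further dimension, spanned by a vector \<open>e\<close> orthogonal to \<open>K0\<close>.
\<close>

lemma orthogonal_projection_exists:
  fixes K :: "('a \<Rightarrow> complex) set" and x :: "'a \<Rightarrow> complex"
  assumes "finite S" and "(\<lambda>_. 0) \<in> K"
    and "\<And>k l. k \<in> K \<Longrightarrow> l \<in> K \<Longrightarrow> (\<lambda>s. k s + l s) \<in> K"
    and "\<And>c k. k \<in> K \<Longrightarrow> (\<lambda>s. c * k s) \<in> K"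
  shows "\<exists>k\<in>K. \<forall>l\<in>K. (\<Sum>s\<in>S. (x s - k s) * cnj (l s)) = 0"
  using assms
proof (induction S arbitrary: K x)
  case empty
  then show ?case by auto
next
  case (insert a S)
  define ip :: "('a \<Rightarrow> complex) \<Rightarrow> ('a \<Rightarrow> complex) \<Rightarrow> complex"
    where "ip k l = (\<Sum>s\<in>insert a S. k s * cnj (l s))" for k l
  define K0 where "K0 = {k \<in> K. k a = 0}"
  have ip_diff: "ip (\<lambda>s. k s - l s) h = ip k h - ip l h" for k l h
    by (simp add: ip_def sum_subtractf left_diff_distrib del: sum.insert)
  have ip_scale: "ip (\<lambda>s. c * k s) h = c * ip k h" for c k h
    by (simp add: ip_def sum_distrib_left mult.assoc del: sum.insert)
  have ip_add2: "ip h (\<lambda>s. k s + c * l s) = ip h k + cnj c * ip h l" for c k l h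
    by (simp add: ip_def sum_distrib_left algebra_simps sum.distrib del: sum.insert)
  have diff: "(\<lambda>s. k s - c * l s) \<in> K" if "k \<in> K" "l \<in> K" for k l c
    using insert.prems(2)[OF that(1) insert.prems(3)[OF that(2), of "- c"]] by simp
  have proj0: "\<exists>k\<in>K0. \<forall>l\<in>K0. ip (\<lambda>s. y s - k s) l = 0" for y
  proof -
    have "\<exists>k\<in>K0. \<forall>l\<in>K0. (\<Sum>s\<in>S. (y s - k s) * cnj (l s)) = 0"
      by (rule insert.IH) (use insert.prems in \<open>auto simp: K0_def\<close>)
    then show ?thesis
      using insert.hyps by (auto simp: ip_def K0_def)
  qed
  have "\<exists>k\<in>K. \<forall>l\<in>K. ip (\<lambda>s. x s - k s) l = 0"
  proof (cases "K0 = K")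
    case True
    then show ?thesis using proj0 by simp
  next
    case False
    then obtain k1 where k1: "k1 \<in> K" "k1 a \<noteq> 0" by (auto simp: K0_def)
    obtain k' where k': "k' \<in> K0" "\<And>l. l \<in> K0 \<Longrightarrow> ip (\<lambda>s. k1 s - k' s) l = 0"
      using proj0 by blast
    define e where "e = (\<lambda>s. k1 s - k' s)"
    have e: "e \<in> K" "e a \<noteq> 0" "\<And>l. l \<in> K0 \<Longrightarrow> ip e l = 0"
      using k1 k' diff[of k1 k' 1] by (auto simp: e_def K0_def)
    have "ip e e \<noteq> 0"
    proof
      assume "ip e e = 0"
      moreover have "ip e e = of_real (\<Sum>s\<in>insert a S. (cmod (e s))\<^sup>2)"
        by (simp add: ip_def complex_norm_square flip: of_real_power del: sum.insert)
      ultimately have "(\<Sum>s\<in>insert a S. (cmod (e s))\<^sup>2) = 0" by (metis of_real_eq_0_iff)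
      then have "(cmod (e a))\<^sup>2 = 0"
        using insert.hyps(1) by (subst (asm) sum_nonneg_eq_0_iff) auto
      with e(2) show False by simp
    qed
    obtain k0 where k0: "k0 \<in> K0" "\<And>l. l \<in> K0 \<Longrightarrow> ip (\<lambda>s. x s - k0 s) l = 0"
      using proj0 by blast
    define c where "c = ip (\<lambda>s. x s - k0 s) e / ip e e"
    define k where "k = (\<lambda>s. k0 s + c * e s)"
    have "k \<in> K"
      using k0 e insert.prems(2,3) by (auto simp: k_def K0_def)
    moreover have "ip (\<lambda>s. x s - k s) l = 0" if "l \<in> K" for l
    proof -
      define b where "b = l a / e a"
      define l0 where "l0 = (\<lambda>s. l s - b * e s)"
      have l0: "l0 \<in> K0"
        using diff[OF that e(1), of b] e(2) by (simp add: l0_def K0_def) (simp add: b_def)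
      have "ip (\<lambda>s. x s - k s) h = ip (\<lambda>s. x s - k0 s) h - c * ip e h" for h
        using ip_diff[of "\<lambda>s. x s - k0 s" "\<lambda>s. c * e s" h]
        by (simp add: k_def ip_scale diff_diff_eq)
      moreover have "ip h l = ip h l0 + cnj b * ip h e" for h
        using ip_add2[of h l0 b e] by (simp add: l0_def)
      ultimately show ?thesis
        using k0(2)[OF l0] e(3)[OF l0] \<open>ip e e \<noteq> 0\<close> by (simp add: c_def)
    qed
    ultimately show ?thesis by blast
  qed
  then show ?case by (simp add: ip_def)
qed

text \<open>
  The matrix acts on coefficient families by transposition, because this is how coefficients
  change when a linear substitution is made in the variables of a polynomial.
\<close>

definition apply_kernel ::
  "'a set \<Rightarrow> ('a \<Rightarrow> 'a \<Rightarrow> complex) \<Rightarrow> ('a \<Rightarrow> complex) \<Rightarrow> 'a \<Rightarrow> complex" where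
  "apply_kernel S T a = (\<lambda>y. \<Sum>x\<in>S. a x * T x y)"

text \<open>
  This is the reductivity of a self-adjoint set of operators. The part \<open>u\<close> of \<open>a\<close> orthogonal to the
  stable subspace \<open>K\<close> is already fixed: \<open>r = T u - u\<close> lies in \<open>K\<close>, so
  \<open>\<langle>r, r\<rangle> = \<langle>r, T u\<rangle> - \<langle>r, u\<rangle> = \<langle>T\<^sup>* r, u\<rangle> - 0 = 0\<close>, as \<open>T\<^sup>* r\<close> again lies in \<open>K\<close>.
\<close>

lemma invariant_representative:
  fixes K :: "('a \<Rightarrow> complex) set" and a :: "'a \<Rightarrow> complex" and \<Gamma> :: "('a \<Rightarrow> 'a \<Rightarrow> complex) set"
  assumes S: "finite S"
    and zero: "(\<lambda>_. 0) \<in> K"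
    and add: "\<And>k l. k \<in> K \<Longrightarrow> l \<in> K \<Longrightarrow> (\<lambda>s. k s + l s) \<in> K"
    and scale: "\<And>c k. k \<in> K \<Longrightarrow> (\<lambda>s. c * k s) \<in> K"
    and adj: "\<And>T. T \<in> \<Gamma> \<Longrightarrow> (\<lambda>x y. cnj (T y x)) \<in> \<Gamma>"
    and stable: "\<And>T k. T \<in> \<Gamma> \<Longrightarrow> k \<in> K \<Longrightarrow> apply_kernel S T k \<in> K"
    and inv: "\<And>T. T \<in> \<Gamma> \<Longrightarrow> (\<lambda>s. apply_kernel S T a s - a s) \<in> K"
  obtains u where "(\<lambda>s. a s - u s) \<in> K" "\<And>T s. T \<in> \<Gamma> \<Longrightarrow> s \<in> S \<Longrightarrow> apply_kernel S T u s = u s"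
proof -
  define ip where "ip k l = (\<Sum>s\<in>S. k s * cnj (l s))" for k l :: "'a \<Rightarrow> complex"
  obtain k where k: "k \<in> K" and orth: "\<And>l. l \<in> K \<Longrightarrow> (\<Sum>s\<in>S. (a s - k s) * cnj (l s)) = 0"
    using orthogonal_projection_exists[OF S zero add scale, of a] by blast
  define u where "u = (\<lambda>s. a s - k s)"
  have ip_u: "ip l u = 0" if "l \<in> K" for l
  proof -
    have "ip l u = cnj (\<Sum>s\<in>S. (a s - k s) * cnj (l s))"
      by (simp add: ip_def u_def mult.commute)
    then show ?thesis using orth[OF that] by simp
  qed
  have "apply_kernel S T u s = u s" if T: "T \<in> \<Gamma>" and s: "s \<in> S" for T s
  proof -
    define r where "r = (\<lambda>s. apply_kernel S T u s - u s)"
    have "r = (\<lambda>s. (apply_kernel S T a s - a s) + (k s + (- 1) * apply_kernel S T k s))"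
      by (auto simp: r_def u_def apply_kernel_def left_diff_distrib sum_subtractf)
    then have r: "r \<in> K"
      using add[OF inv[OF T] add[OF k scale[OF stable[OF T k], of "-1"]]] by simp
    have "ip h (\<lambda>s. k s - l s) = ip h k - ip h l" for h k l
      by (simp add: ip_def right_diff_distrib sum_subtractf)
    moreover have "ip r r = ip r (\<lambda>s. apply_kernel S T u s - u s)"
      by (simp only: r_def)
    ultimately have "ip r r = ip r (apply_kernel S T u) - ip r u"
      by (simp only:)
    also have "ip r (apply_kernel S T u) = ip (apply_kernel S (\<lambda>x y. cnj (T y x)) r) u"
      unfolding ip_def apply_kernel_def
      by (simp add: sum_distrib_left sum_distrib_right mult.assoc mult.left_commute)
        (subst sum.swap, simp add: mult_ac)
    finally have "ip r r = 0" using ip_u r stable[OF adj[OF T] r] by simp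
    moreover have "ip r r = of_real (\<Sum>s\<in>S. (cmod (r s))\<^sup>2)"
      by (simp add: ip_def complex_norm_square flip: of_real_power)
    ultimately have "(\<Sum>s\<in>S. (cmod (r s))\<^sup>2) = 0" by (metis of_real_eq_0_iff)
    then have "(cmod (r s))\<^sup>2 = 0"
      using S s by (subst (asm) sum_nonneg_eq_0_iff) auto
    then show ?thesis by (simp add: r_def)
  qed
  with k show thesis by (intro that[of u]) (auto simp: u_def)
qed

section \<open>Polynomial functions and their coefficients\<close>

text \<open>
  The multilinear form of degree \<open>d\<close> with coefficients \<open>a (d, f)\<close>, where \<open>f\<close> lists the coordinates
  used by the \<open>d\<close> arguments. On the diagonal it is a homogeneous polynomial of degree \<open>d\<close>. There is one
  coefficient for each word \<open>f\<close>, not for each monomial: the polynomial does not determine them, but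
  the inner product and the action of matrices on coefficients stay free of multinomial factors. The
  degree is part of the index so that one family \<open>a\<close> describes an inhomogeneous polynomial.
\<close>

definition multi_form :: "(nat \<times> (nat \<Rightarrow> 'n) \<Rightarrow> complex) \<Rightarrow> nat \<Rightarrow> (nat \<Rightarrow> complex^'n) \<Rightarrow> complex" where
  "multi_form a d v = (\<Sum>f\<in>{..<d} \<rightarrow>\<^sub>E UNIV. a (d, f) * (\<Prod>i<d. v i $ f i))"

definition indices :: "nat \<Rightarrow> (nat \<times> (nat \<Rightarrow> 'n)) set" where
  "indices N = Sigma {..N} (\<lambda>d. {..<d} \<rightarrow>\<^sub>E UNIV)"

lemma finite_indices: "finite (indices N :: (nat \<times> (nat \<Rightarrow> 'n::finite)) set)"
  by (auto simp: indices_def intro!: finite_PiE)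

lemma sum_multi_form:
  fixes x :: "complex^'n::finite"
  shows "(\<Sum>d\<le>N. multi_form a d (\<lambda>_. x)) = (\<Sum>(d, f)\<in>indices N. a (d, f) * (\<Prod>i<d. x $ f i))"
  unfolding multi_form_def indices_def by (rule sum.Sigma) (auto intro!: finite_PiE)

lemma multi_form_add: "multi_form (\<lambda>y. a y + b y) d v = multi_form a d v + multi_form b d v"
  by (simp add: multi_form_def algebra_simps sum.distrib)

lemma multi_form_diff: "multi_form (\<lambda>y. a y - b y) d v = multi_form a d v - multi_form b d v"
  by (simp add: multi_form_def algebra_simps sum_subtractf)

lemma multi_form_scale: "multi_form (\<lambda>y. c * a y) d v = c * multi_form a d v"
  by (simp add: multi_form_def sum_distrib_left mult.assoc)

lemma multi_form_zero: "multi_form (\<lambda>_. 0) d v = 0"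
  by (simp add: multi_form_def)

lemma multi_form_smult: "multi_form a d (\<lambda>i. c *s v i) = c ^ d * multi_form a d v"
  by (simp add: multi_form_def prod.distrib sum_distrib_left mult_ac)

lemma multi_form_cong: "(\<And>i. i < d \<Longrightarrow> v i = w i) \<Longrightarrow> multi_form a d v = multi_form a d w"
  by (simp add: multi_form_def)

lemma multi_form_degree_zero: "multi_form a 0 v = a (0, \<lambda>_. undefined)"
  by (simp add: multi_form_def)

lemma multi_form_at_zero: "multi_form a d (\<lambda>_. 0) = (if d = 0 then a (0, \<lambda>_. undefined) else 0)"
  by (cases "d = 0") (simp_all add: multi_form_def power_0_left)

text \<open>
  Polynomial functions are built inductively, and multiplying two expansions would need a convolution
  of coefficients. It is enough to multiply an expansion by one coordinate at a time: this shows that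
  expandable functions are closed under multiplication by any polynomial, and then the constant \<open>1\<close>
  is multiplied by it.
\<close>

definition expandable :: "(complex^'n \<Rightarrow> complex) \<Rightarrow> bool" where
  "expandable p \<longleftrightarrow> (\<exists>a N. p = (\<lambda>x. \<Sum>d\<le>N. multi_form a d (\<lambda>_. x)))"

lemma expandable_monomial:
  fixes f :: "nat \<Rightarrow> 'n::finite"
  assumes "f \<in> {..<d} \<rightarrow>\<^sub>E UNIV"
  shows "expandable (\<lambda>x. c * (\<Prod>i<d. x $ f i))"
proof -
  have eq: "c * (\<Prod>i<d. x $ f i) = (\<Sum>e\<le>d. multi_form (\<lambda>y. if y = (d, f) then c else 0) e (\<lambda>_. x))" for x
  proof -
    have "(\<Sum>e\<le>d. multi_form (\<lambda>y. if y = (d, f) then c else 0) e (\<lambda>_. x))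
        = (\<Sum>y\<in>indices d. if y = (d, f) then c * (\<Prod>i<d. x $ f i) else 0)"
      unfolding sum_multi_form
    proof (rule sum.cong[OF refl])
      fix y :: "nat \<times> (nat \<Rightarrow> 'n)"
      show "(case y of (e, h) \<Rightarrow> (if (e, h) = (d, f) then c else 0) * (\<Prod>i<e. x $ h i))
          = (if y = (d, f) then c * (\<Prod>i<d. x $ f i) else 0)"
        by (cases y, cases "y = (d, f)") (auto simp del: mult_eq_0_iff prod_zero_iff)
    qed
    then show ?thesis
      using assms by (simp add: finite_indices) (simp add: indices_def)
  qed
  show ?thesis unfolding expandable_def by (intro exI ext, rule eq)
qed

lemma expandable_add:
  fixes p q :: "complex^'n::finite \<Rightarrow> complex"
  assumes "expandable p" and "expandable q"
  shows "expandable (\<lambda>x. p x + q x)"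
proof -
  obtain a N b M where p: "p = (\<lambda>x. \<Sum>d\<le>N. multi_form a d (\<lambda>_. x))"
    and q: "q = (\<lambda>x. \<Sum>d\<le>M. multi_form b d (\<lambda>_. x))"
    using assms unfolding expandable_def by metis
  have cut: "(\<Sum>d\<le>K. multi_form a d (\<lambda>_. x))
      = (\<Sum>d\<le>max K L. multi_form (\<lambda>y. if fst y \<le> K then a y else 0) d (\<lambda>_. x))"
    for K L a and x :: "complex^'n"
    by (rule sum.mono_neutral_cong_left) (auto simp: multi_form_def)
  have eq: "p x + q x = (\<Sum>d\<le>max N M. multi_form (\<lambda>y. (if fst y \<le> N then a y else 0)
      + (if fst y \<le> M then b y else 0)) d (\<lambda>_. x))" for x
    using cut[of a x N M] cut[of b x M N] by (simp add: p q multi_form_add sum.distrib max.commute)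
  show ?thesis unfolding expandable_def by (intro exI ext, rule eq)
qed

lemma expandable_sum:
  fixes p :: "'b \<Rightarrow> complex^'n::finite \<Rightarrow> complex"
  assumes "finite S" and "\<And>s. s \<in> S \<Longrightarrow> expandable (p s)"
  shows "expandable (\<lambda>x. \<Sum>s\<in>S. p s x)"
  using assms
proof (induction S rule: finite_induct)
  case empty
  then show ?case using expandable_monomial[of "\<lambda>_. undefined" 0 0] by simp
next
  case (insert s S)
  then show ?case using expandable_add[of "p s" "\<lambda>x. \<Sum>s\<in>S. p s x"] by simp
qed

lemma expandable_coord_mult:
  fixes p :: "complex^'n::finite \<Rightarrow> complex"
  assumes "expandable p"
  shows "expandable (\<lambda>x. x $ i * p x)"
proof -
  obtain a N where p: "p = (\<lambda>x. \<Sum>d\<le>N. multi_form a d (\<lambda>_. x))"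
    using assms unfolding expandable_def by metis
  have "x $ i * p x = (\<Sum>y\<in>indices N. a y * (\<Prod>j<Suc (fst y). x $ ((snd y)(fst y := i)) j))" for x
    unfolding p sum_multi_form sum_distrib_left
    by (rule sum.cong) (auto simp: mult_ac)
  moreover have "expandable (\<lambda>x. \<Sum>y\<in>indices N.
      a y * (\<Prod>j<Suc (fst y). x $ ((snd y)(fst y := i)) j))"
    by (intro expandable_sum expandable_monomial finite_indices)
      (auto simp: indices_def PiE_iff extensional_def)
  ultimately show ?thesis by simp
qed

lemma expandable_mult:
  fixes p q :: "complex^'n::finite \<Rightarrow> complex"
  assumes "complex_polynomial_function p" and "expandable q"
  shows "expandable (\<lambda>x. p x * q x)"
  using assms
proof (induction p arbitrary: q rule: complex_polynomial_function.induct)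
  case (coord i)
  then show ?case by (rule expandable_coord_mult)
next
  case (const c)
  then obtain a N where q: "q = (\<lambda>x. \<Sum>d\<le>N. multi_form a d (\<lambda>_. x))"
    unfolding expandable_def by metis
  have eq: "c * q x = (\<Sum>d\<le>N. multi_form (\<lambda>y. c * a y) d (\<lambda>_. x))" for x
    by (simp add: q multi_form_scale sum_distrib_left)
  show ?case unfolding expandable_def by (intro exI ext, rule eq)
next
  case (add f g)
  then show ?case using expandable_add[OF add.IH] by (simp add: distrib_right)
next
  case (mult f g)
  then show ?case by (simp add: mult.assoc)
qed

lemma polynomial_expansion:
  fixes p :: "complex^'n::finite \<Rightarrow> complex"
  assumes "complex_polynomial_function p"
  obtains a N where "p = (\<lambda>x. \<Sum>d\<le>N. multi_form a d (\<lambda>_. x))"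
proof -
  have "expandable (\<lambda>x. p x * 1)"
    using expandable_monomial[of "\<lambda>_. undefined" 0 1] by (intro expandable_mult assms) simp
  then show thesis using that unfolding expandable_def by auto
qed

lemma polynomial_sum:
  "finite S \<Longrightarrow> (\<And>s. s \<in> S \<Longrightarrow> complex_polynomial_function (p s)) \<Longrightarrow>
    complex_polynomial_function (\<lambda>x. \<Sum>s\<in>S. p s x)"
  by (induction S rule: finite_induct) (auto intro: complex_polynomial_function.intros)

lemma polynomial_prod:
  "finite S \<Longrightarrow> (\<And>s. s \<in> S \<Longrightarrow> complex_polynomial_function (p s)) \<Longrightarrow>
    complex_polynomial_function (\<lambda>x. \<Prod>s\<in>S. p s x)"
  by (induction S rule: finite_induct) (auto intro: complex_polynomial_function.intros)

lemma polynomial_diff: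
  assumes "complex_polynomial_function p" "complex_polynomial_function q"
  shows "complex_polynomial_function (\<lambda>x. p x - q x)"
  using complex_polynomial_function.add[OF assms(1)
      complex_polynomial_function.mult[OF complex_polynomial_function.const[of "-1"] assms(2)]]
  by simp

lemma polynomial_linear_comp:
  fixes A :: "complex^'n::finite^'k::finite"
  assumes "complex_polynomial_function p"
  shows "complex_polynomial_function (\<lambda>x. p (A *v x))"
  using assms
  by induction (auto simp: matrix_vector_mult_def
      intro!: polynomial_sum complex_polynomial_function.intros)

lemma polynomial_multi_form:
  "complex_polynomial_function (\<lambda>x :: complex^'n::finite. multi_form a d (\<lambda>_. x))"
  unfolding multi_form_def
  by (intro polynomial_sum polynomial_prod complex_polynomial_function.intros)
    (auto intro!: finite_PiE)

text \<open>
  The block diagonal matrix by which \<open>A\<close> acts on the sum of all tensor powers.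
\<close>

definition tensor_power_kernel ::
  "complex^'n^'n \<Rightarrow> nat \<times> (nat \<Rightarrow> 'n) \<Rightarrow> nat \<times> (nat \<Rightarrow> 'n) \<Rightarrow> complex" where
  "tensor_power_kernel A = (\<lambda>(d, f) (e, h). if d = e then \<Prod>i<d. A $ f i $ h i else 0)"

lemma multi_form_apply_kernel:
  fixes A :: "complex^'n::finite^'n"
  assumes "d \<le> N"
  shows "multi_form (apply_kernel (indices N) (tensor_power_kernel A) a) d v = multi_form a d (\<lambda>i. A *v v i)"
proof -
  let ?F = "{..<d} \<rightarrow>\<^sub>E (UNIV :: 'n set)"
  have fin: "finite ?F" by (auto intro!: finite_PiE)
  have "apply_kernel (indices N) (tensor_power_kernel A) a (d, h)
      = (\<Sum>f\<in>?F. a (d, f) * (\<Prod>i<d. A $ f i $ h i))" for h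
  proof -
    have "apply_kernel (indices N) (tensor_power_kernel A) a (d, h)
        = (\<Sum>e\<le>N. \<Sum>f\<in>{..<e} \<rightarrow>\<^sub>E UNIV. a (e, f) * tensor_power_kernel A (e, f) (d, h))"
      unfolding apply_kernel_def indices_def
      by (subst sum.Sigma) (auto intro!: finite_PiE)
    also have "\<dots> = (\<Sum>e\<le>N. if e = d then \<Sum>f\<in>?F. a (d, f) * (\<Prod>i<d. A $ f i $ h i) else 0)"
      by (intro sum.cong) (auto simp: tensor_power_kernel_def)
    finally show ?thesis using assms by simp
  qed
  moreover have "(\<Prod>i<d. (A *v v i) $ f i) = (\<Sum>h\<in>?F. \<Prod>i<d. A $ f i $ h i * v i $ h i)" for f
    by (simp add: matrix_vector_mult_def prod_sum_PiE)
  ultimately have "multi_form (apply_kernel (indices N) (tensor_power_kernel A) a) d v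
        = (\<Sum>h\<in>?F. \<Sum>f\<in>?F. a (d, f) * (\<Prod>i<d. A $ f i $ h i) * (\<Prod>i<d. v i $ h i))"
      and "multi_form a d (\<lambda>i. A *v v i)
        = (\<Sum>f\<in>?F. \<Sum>h\<in>?F. a (d, f) * (\<Prod>i<d. A $ f i $ h i) * (\<Prod>i<d. v i $ h i))"
    unfolding multi_form_def
    by (simp_all only: sum_distrib_left sum_distrib_right prod.distrib mult.assoc)
  then show ?thesis by (simp only:) (rule sum.swap)
qed

section \<open>The action on tensors\<close>

definition tensor_matrix :: "complex^'m::finite^'m \<Rightarrow> complex^('d::finite \<Rightarrow> 'm)^('d \<Rightarrow> 'm)" where
  "tensor_matrix g = (\<chi> \<mu> \<nu>. \<Prod>j\<in>UNIV. g $ \<mu> j $ \<nu> j)"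

lemma tensor_act_eq: "tensor_act g v = tensor_matrix g *v v"
  by (simp add: tensor_act_def tensor_matrix_def matrix_vector_mult_def)

lemma tensor_act_add: "tensor_act g (v + w) = tensor_act g v + tensor_act g w"
  by (simp add: tensor_act_eq matrix_vector_right_distrib)

lemma tensor_act_smult: "tensor_act g (c *s v) = c *s tensor_act g v"
  by (simp add: tensor_act_eq vector_scalar_commute)

lemma prod_sum_UNIV:
  fixes f :: "'a::finite \<Rightarrow> 'b::finite \<Rightarrow> 'c::comm_semiring_1"
  shows "(\<Prod>x\<in>UNIV. \<Sum>y\<in>UNIV. f x y) = (\<Sum>h\<in>UNIV. \<Prod>x\<in>UNIV. f x (h x))"
  by (subst prod_sum_PiE) (auto simp: PiE_UNIV_domain)

lemma tensor_matrix_mult: "tensor_matrix (g ** h) = tensor_matrix g ** tensor_matrix h"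
  by (simp add: tensor_matrix_def matrix_matrix_mult_def vec_eq_iff prod_sum_UNIV prod.distrib)

lemma tensor_act_mult: "tensor_act g (tensor_act h v) = tensor_act (g ** h) v"
  by (simp add: tensor_act_eq tensor_matrix_mult matrix_vector_mul_assoc)

text \<open>
  Scalar matrices act through \<open>D\<close>-th powers; this is why the degree of an invariant and the exponent
  of the determinant are linked.
\<close>

lemma tensor_act_mat:
  fixes v :: "('d::finite, 'm::finite) tensor"
  shows "tensor_act (mat c) v = c ^ CARD('d) *s v"
proof -
  have "(\<Prod>j\<in>(UNIV :: 'd set). (mat c :: complex^'m^'m) $ \<mu> j $ \<nu> j) = (if \<mu> = \<nu> then c ^ CARD('d) else 0)" for \<mu> \<nu>
    by (auto simp: mat_def fun_eq_iff intro!: prod_zero)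
  then show ?thesis
    by (simp add: tensor_act_def vec_eq_iff if_distrib[of "\<lambda>x. x * _"] cong: if_cong)
qed

definition adjoint_mat :: "complex^'n^'n \<Rightarrow> complex^'n^'n" where
  "adjoint_mat A = (\<chi> i j. cnj (A $ j $ i))"

lemma det_adjoint_mat: "det (adjoint_mat A) = cnj (det A)"
proof -
  have "adjoint_mat A = transpose (\<chi> i j. cnj (A $ i $ j))"
    by (simp add: adjoint_mat_def transpose_def)
  moreover have "det (\<chi> i j. cnj (A $ i $ j)) = cnj (det A)"
    by (simp add: det_def)
  ultimately show ?thesis by (simp add: det_transpose)
qed

lemma tensor_matrix_adjoint: "tensor_matrix (adjoint_mat g) = adjoint_mat (tensor_matrix g)"
  by (simp add: tensor_matrix_def adjoint_mat_def vec_eq_iff)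

text \<open>
  Together with \<open>tensor_matrix_adjoint\<close> and \<open>det_adjoint_mat\<close>, this says that the operators by which the
  matrices of determinant \<open>1\<close> act on coefficients form a set closed under adjoints.
\<close>

lemma tensor_power_kernel_adjoint: "(\<lambda>x y. cnj (tensor_power_kernel A y x)) = tensor_power_kernel (adjoint_mat A)"
  by (auto simp: tensor_power_kernel_def adjoint_mat_def fun_eq_iff)

section \<open>Powers of vectors and multilinear forms\<close>

definition vector_power :: "complex^'m \<Rightarrow> ('d::finite, 'm::finite) tensor" where
  "vector_power l = (\<chi> \<nu>. \<Prod>j\<in>UNIV. l $ \<nu> j)"

lemma tensor_act_vector_power: "tensor_act g (vector_power l) = vector_power (g *v l)"
  by (simp add: tensor_act_def vector_power_def matrix_vector_mult_def vec_eq_iff prod_sum_UNIV prod.distrib)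

lemma sum_signed_supersets:
  fixes R :: "'d::finite set"
  shows "(\<Sum>S | R \<subseteq> S. (- 1 :: complex) ^ card S) = (if R = UNIV then (- 1) ^ CARD('d) else 0)"
proof (cases "R = UNIV")
  case True
  then have "{S. R \<subseteq> S} = {UNIV}" by auto
  with True show ?thesis by simp
next
  case False
  have "card {S. S \<subseteq> UNIV \<and> R \<subseteq> S \<and> even (card S)} = card {S. S \<subseteq> UNIV \<and> R \<subseteq> S \<and> odd (card S)}"
    using False by (intro card_subsupersets_even_odd) auto
  then show ?thesis
    using False by (subst sum_alternating_cancels) auto
qed

text \<open>
  Ryser's formula for permanents, as a polarisation identity: expanding the power of a partial sum of
  basis vectors gives all words in its summands, and the alternating sum keeps
  only the words that use every summand.
\<close>

lemma signed_sum_of_powers: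
  fixes \<nu> \<mu> :: "'d::finite \<Rightarrow> 'm::finite"
  shows "(\<Sum>S\<in>UNIV. (- 1) ^ card S * vector_power (\<Sum>s\<in>S. axis (\<nu> s) 1) $ \<mu>)
    = (- 1) ^ CARD('d) * of_nat (card {\<pi>. \<pi> permutes UNIV \<and> \<nu> \<circ> \<pi> = \<mu>})"
proof -
  have pow: "vector_power (\<Sum>s\<in>S. axis (\<nu> s) 1) $ \<mu>
      = (\<Sum>\<phi>\<in>UNIV. if range \<phi> \<subseteq> S \<and> \<nu> \<circ> \<phi> = \<mu> then 1 else 0)" for S :: "'d set"
  proof -
    have "vector_power (\<Sum>s\<in>S. axis (\<nu> s) 1) $ \<mu>
        = (\<Prod>j\<in>UNIV. \<Sum>s\<in>UNIV. if s \<in> S \<and> \<mu> j = \<nu> s then 1 else 0)"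
      by (simp add: vector_power_def axis_def sum.If_cases Int_def)
    also have "\<dots> = (\<Sum>\<phi>\<in>UNIV. \<Prod>j\<in>UNIV. if \<phi> j \<in> S \<and> \<mu> j = \<nu> (\<phi> j) then 1 else 0)"
      by (rule prod_sum_UNIV)
    also have "\<dots> = (\<Sum>\<phi>\<in>UNIV. if range \<phi> \<subseteq> S \<and> \<nu> \<circ> \<phi> = \<mu> then 1 else 0)"
    proof (rule sum.cong[OF refl])
      fix \<phi> :: "'d \<Rightarrow> 'd"
      show "(\<Prod>j\<in>UNIV. if \<phi> j \<in> S \<and> \<mu> j = \<nu> (\<phi> j) then 1 else (0::complex))
          = (if range \<phi> \<subseteq> S \<and> \<nu> \<circ> \<phi> = \<mu> then 1 else 0)"
      proof (cases "range \<phi> \<subseteq> S \<and> \<nu> \<circ> \<phi> = \<mu>")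
        case False
        have "\<exists>j. \<not> (\<phi> j \<in> S \<and> \<mu> j = \<nu> (\<phi> j))"
        proof (rule ccontr)
          assume "\<nexists>j. \<not> (\<phi> j \<in> S \<and> \<mu> j = \<nu> (\<phi> j))"
          then have "\<phi> j \<in> S" "\<nu> (\<phi> j) = \<mu> j" for j by simp_all
          then have "range \<phi> \<subseteq> S \<and> \<nu> \<circ> \<phi> = \<mu>" by auto
          with False show False ..
        qed
        then have "(\<Prod>j\<in>UNIV. if \<phi> j \<in> S \<and> \<mu> j = \<nu> (\<phi> j) then 1 else (0::complex)) = 0"
          by (intro prod_zero) auto
        with False show ?thesis by (simp only: if_False)
      qed (auto intro!: prod.neutral)
    qed
    finally show ?thesis .
  qed
  have surj: "range \<phi> = UNIV \<longleftrightarrow> \<phi> permutes UNIV" for \<phi> :: "'d \<Rightarrow> 'd"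
  proof
    assume "range \<phi> = UNIV"
    then have "bij \<phi>" by (simp add: bij_def finite_UNIV_surj_inj)
    then show "\<phi> permutes UNIV" by (rule bij_imp_permutes) simp
  qed (rule permutes_surj)
  have "(\<Sum>S\<in>UNIV. (- 1) ^ card S * vector_power (\<Sum>s\<in>S. axis (\<nu> s) 1) $ \<mu>)
      = (\<Sum>\<phi>\<in>UNIV. \<Sum>S\<in>UNIV. (- 1) ^ card S * (if range \<phi> \<subseteq> S \<and> \<nu> \<circ> \<phi> = \<mu> then 1 else 0))"
    unfolding pow sum_distrib_left by (rule sum.swap)
  also have "\<dots> = (\<Sum>\<phi>\<in>UNIV. if \<nu> \<circ> \<phi> = \<mu> then \<Sum>S | range \<phi> \<subseteq> S. (- 1) ^ card S else 0)"
    by (intro sum.cong) (auto simp: sum.If_cases Int_def if_distrib[of "\<lambda>x. _ * x"] cong: if_cong)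
  also have "\<dots> = (\<Sum>\<phi>\<in>UNIV. if \<phi> permutes UNIV \<and> \<nu> \<circ> \<phi> = \<mu> then (- 1) ^ CARD('d) else 0)"
    by (intro sum.cong refl) (simp add: sum_signed_supersets surj)
  finally show ?thesis by (simp add: sum.If_cases Int_def)
qed

text \<open>
  Summing the polarisation identity with the coordinates of \<open>w\<close> as weights recovers \<open>D!\<close> times \<open>w\<close>, up
  to sign.
\<close>

lemma sym_forms_span_powers:
  "(sym_forms :: ('d::finite, 'm::finite) tensor set) \<subseteq> vec.span (range vector_power)"
proof
  fix w :: "('d, 'm) tensor"
  assume w: "w \<in> sym_forms"
  define x :: "('d, 'm) tensor" where "x = (\<Sum>\<nu>\<in>UNIV. \<Sum>S\<in>UNIV.
    (w $ \<nu> * (- 1) ^ card S) *s vector_power (\<Sum>s\<in>S. axis (\<nu> s) 1))"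
  define c :: complex where "c = (- 1) ^ CARD('d) * fact (CARD('d))"
  have "x $ \<mu> = c * w $ \<mu>" for \<mu> :: "'d \<Rightarrow> 'm"
  proof -
    have "x $ \<mu> = (\<Sum>\<nu>\<in>UNIV. w $ \<nu> * (\<Sum>S\<in>UNIV. (- 1) ^ card S * vector_power (\<Sum>s\<in>S. axis (\<nu> s) 1) $ \<mu>))"
      by (simp add: x_def sum_distrib_left mult.assoc)
    also have "\<dots> = (- 1) ^ CARD('d) *
        (\<Sum>\<nu>\<in>UNIV. \<Sum>\<pi> | \<pi> permutes UNIV. if \<nu> \<circ> \<pi> = \<mu> then w $ \<nu> else 0)"
      unfolding signed_sum_of_powers
      by (simp add: sum_distrib_left sum.If_cases Int_def mult_ac)
    also have "(\<Sum>\<nu>\<in>UNIV. \<Sum>\<pi> | \<pi> permutes UNIV. if \<nu> \<circ> \<pi> = \<mu> then w $ \<nu> else 0)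
        = (\<Sum>\<pi> | \<pi> permutes (UNIV :: 'd set). w $ \<mu>)"
    proof (subst sum.swap, rule sum.cong[OF refl])
      fix \<pi> :: "'d \<Rightarrow> 'd"
      assume "\<pi> \<in> {\<pi>. \<pi> permutes UNIV}"
      then have \<pi>: "\<pi> permutes UNIV" by simp
      have "(if \<nu> \<circ> \<pi> = \<mu> then w $ \<nu> else 0) = (if \<nu> = \<mu> \<circ> inv \<pi> then w $ \<mu> else 0)" for \<nu>
      proof -
        have "\<nu> \<circ> \<pi> = \<mu> \<longleftrightarrow> \<nu> = \<mu> \<circ> inv \<pi>"
          using permutes_inv_o[OF \<pi>] by (auto simp: o_assoc[symmetric])
        moreover have "w $ (\<nu> \<circ> \<pi>) = w $ \<nu>" using w \<pi> by (simp add: sym_forms_def)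
        ultimately show ?thesis by auto
      qed
      then show "(\<Sum>\<nu>\<in>UNIV. if \<nu> \<circ> \<pi> = \<mu> then w $ \<nu> else 0) = w $ \<mu>" by simp
    qed
    also have "\<dots> = fact CARD('d) * w $ \<mu>"
      by (simp add: card_permutations)
    finally show ?thesis by (simp add: c_def)
  qed
  then have "w = (1 / c) *s x" by (simp add: vec_eq_iff c_def)
  moreover have "x \<in> vec.span (range vector_power)"
    unfolding x_def by (intro vec.span_sum vec.span_scale vec.span_base) auto
  ultimately show "w \<in> vec.span (range vector_power)" by (simp add: vec.span_scale)
qed

lemma prod_fun_upd:
  assumes "finite I" "j \<in> I"
  shows "(\<Prod>i\<in>I. F i ((v(j := x)) i)) = F j x * (\<Prod>i\<in>I - {j}. F i (v i) :: complex)"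
proof -
  have "(\<Prod>i\<in>I. F i ((v(j := x)) i)) = F j x * (\<Prod>i\<in>I - {j}. F i ((v(j := x)) i))"
    using prod.remove[OF assms, of "\<lambda>i. F i ((v(j := x)) i)"] by simp
  also have "(\<Prod>i\<in>I - {j}. F i ((v(j := x)) i)) = (\<Prod>i\<in>I - {j}. F i (v i))"
    by (rule prod.cong) auto
  finally show ?thesis .
qed

definition multilinear_on :: "'i set \<Rightarrow> (('i \<Rightarrow> complex^'n) \<Rightarrow> complex) \<Rightarrow> bool" where
  "multilinear_on I M \<longleftrightarrow> (\<forall>j\<in>I. \<forall>v x y c.
     M (v(j := x + y)) = M (v(j := x)) + M (v(j := y)) \<and> M (v(j := c *s x)) = c * M (v(j := x)))"

lemma multilinear_scale:
  assumes "multilinear_on I M"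
  shows "multilinear_on I (\<lambda>v. c * M v)"
  unfolding multilinear_on_def
proof (intro ballI allI)
  fix j v x y b
  assume "j \<in> I"
  with assms have "M (v(j := x + y)) = M (v(j := x)) + M (v(j := y))"
    and "M (v(j := b *s x)) = b * M (v(j := x))"
    unfolding multilinear_on_def by blast+
  then show "c * M (v(j := x + y)) = c * M (v(j := x)) + c * M (v(j := y)) \<and>
      c * M (v(j := b *s x)) = b * (c * M (v(j := x)))"
    by (simp only: distrib_left mult.left_commute)
qed

lemma multilinear_multi_form: "multilinear_on {..<d} (multi_form a d)"
proof -
  have "multi_form a d (v(j := x))
      = (\<Sum>f\<in>{..<d} \<rightarrow>\<^sub>E UNIV. a (d, f) * (x $ f j * (\<Prod>i\<in>{..<d} - {j}. v i $ f i)))"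
    if "j < d" for v j x
    unfolding multi_form_def
    using that by (subst prod_fun_upd[where F = "\<lambda>i x. x $ _ i"]) auto
  then show ?thesis
    by (simp add: multilinear_on_def algebra_simps sum.distrib sum_distrib_left)
qed

lemma multilinear_reindex:
  assumes M: "multilinear_on {..<d} M" and b: "bij_betw b {..<d} I"
    and cong: "\<And>v w. (\<And>i. i < d \<Longrightarrow> v i = w i) \<Longrightarrow> M v = M w"
  shows "multilinear_on I (\<lambda>v. M (\<lambda>i. v (b i)))"
proof -
  have upd: "\<exists>k<d. \<forall>v x. M (\<lambda>i. (v(j := x)) (b i)) = M ((\<lambda>i. v (b i))(k := x))" if j: "j \<in> I" for j
  proof -
    obtain k where k: "k < d" "b k = j"
      using b j unfolding bij_betw_def by auto
    have "b i = j \<longleftrightarrow> i = k" if "i < d" for i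
      using b k that unfolding bij_betw_def inj_on_def by auto
    then have "M (\<lambda>i. (v(j := x)) (b i)) = M ((\<lambda>i. v (b i))(k := x))" for v x
      by (intro cong) auto
    with k show ?thesis by blast
  qed
  show ?thesis
    unfolding multilinear_on_def
  proof (intro ballI allI)
    fix j v x y c
    assume "j \<in> I"
    then obtain k where k: "k < d" "\<And>v x. M (\<lambda>i. (v(j := x)) (b i)) = M ((\<lambda>i. v (b i))(k := x))"
      using upd by blast
    show "M (\<lambda>i. (v(j := x + y)) (b i)) = M (\<lambda>i. (v(j := x)) (b i)) + M (\<lambda>i. (v(j := y)) (b i)) \<and>
        M (\<lambda>i. (v(j := c *s x)) (b i)) = c * M (\<lambda>i. (v(j := x)) (b i))"
      unfolding k(2) using M k(1) unfolding multilinear_on_def by simp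
  qed
qed

text \<open>
  Linearity in one argument extends an equality from powers to their span, so powers are replaced by
  arbitrary symmetric tensors one argument at a time.
\<close>

lemma multilinear_eq_on_sym_forms:
  fixes M M' :: "('i \<Rightarrow> ('d::finite, 'm::finite) tensor) \<Rightarrow> complex"
  assumes "finite I" and M: "multilinear_on I M" and M': "multilinear_on I M'"
    and pow: "\<And>v. (\<And>i. i \<in> I \<Longrightarrow> v i \<in> range vector_power) \<Longrightarrow> M v = M' v"
    and v: "\<And>i. i \<in> I \<Longrightarrow> v i \<in> sym_forms"
  shows "M v = M' v"
proof -
  have "\<forall>v. (\<forall>i\<in>J. v i \<in> sym_forms) \<and> (\<forall>i\<in>I - J. v i \<in> range vector_power) \<longrightarrow> M v = M' v"
    if "J \<subseteq> I" for J
    using finite_subset[OF that \<open>finite I\<close>] that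
  proof (induction J rule: finite_induct)
    case empty
    then show ?case using pow by simp
  next
    case (insert j J)
    have j: "j \<in> I" using insert by simp
    show ?case
    proof (intro allI impI)
      fix v :: "'i \<Rightarrow> ('d, 'm) tensor"
      assume v: "(\<forall>i\<in>insert j J. v i \<in> sym_forms) \<and> (\<forall>i\<in>I - insert j J. v i \<in> range vector_power)"
      let ?T = "{x. M (v(j := x)) = M' (v(j := x))}"
      have "vec.subspace ?T"
      proof (rule vec.subspaceI)
        have "N (v(j := 0)) = 0" if "multilinear_on I N" for N
          using that j unfolding multilinear_on_def by (metis mult_zero_left vector_smult_lzero)
        from this[OF M] this[OF M'] show "0 \<in> ?T" by simp
      qed (use M M' j in \<open>auto simp: multilinear_on_def\<close>)
      moreover have "range vector_power \<subseteq> ?T"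
      proof
        fix x :: "('d, 'm) tensor" assume "x \<in> range vector_power"
        with v insert show "x \<in> ?T" by auto
      qed
      ultimately have "vec.span (range vector_power) \<subseteq> ?T" by (intro vec.span_minimal)
      moreover have "v j \<in> vec.span (range vector_power)" using v sym_forms_span_powers by auto
      ultimately have "v j \<in> ?T" by blast
      then show "M v = M' v" by simp
    qed
  qed
  from this[of I] v show ?thesis by simp
qed

section \<open>The polarised generic invariant\<close>

text \<open>
  The polarisation of the generic fundamental invariant: the \<open>m\<close> factors of each product receive
  different arguments. It is a better object to compare with, since on powers it is
  a power of a determinant.
\<close>

definition polar_invariant :: "('m \<Rightarrow> ('d::finite, 'm::finite) tensor) \<Rightarrow> complex" where
  "polar_invariant v = (\<Sum>\<sigma> | \<forall>j. \<sigma> j permutes (UNIV :: 'm set).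
     (\<Prod>j\<in>UNIV. of_int (sign (\<sigma> j))) * (\<Prod>i\<in>UNIV. v i $ (\<lambda>j. \<sigma> j i)))"

lemma generic_invariant_eq_polar: "generic_invariant v = polar_invariant (\<lambda>_. v)"
  by (simp add: generic_invariant_def polar_invariant_def)

lemma multilinear_polar_invariant:
  "multilinear_on UNIV (polar_invariant :: ('m \<Rightarrow> ('d::finite, 'm::finite) tensor) \<Rightarrow> complex)"
proof -
  have "polar_invariant (v(k := x)) = (\<Sum>\<sigma> | \<forall>j. \<sigma> j permutes (UNIV :: 'm set).
     (\<Prod>j\<in>UNIV. of_int (sign (\<sigma> j))) * (x $ (\<lambda>j. \<sigma> j k) * (\<Prod>i\<in>UNIV - {k}. v i $ (\<lambda>j. \<sigma> j i))))"
    for v and k :: 'm and x :: "('d, 'm) tensor"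
    unfolding polar_invariant_def
    by (subst prod_fun_upd[where F = "\<lambda>i x. x $ (\<lambda>j. _ j i)"]) auto
  then show ?thesis
    by (simp add: multilinear_on_def algebra_simps sum.distrib sum_distrib_left)
qed

text \<open>
  On powers the sum over \<open>\<sigma>\<close> factors into \<open>D\<close> independent sums over a single permutation, each of
  which is the Leibniz formula.
\<close>

lemma polar_invariant_vector_power:
  fixes l :: "'m::finite \<Rightarrow> complex^'m"
  shows "polar_invariant (\<lambda>i. vector_power (l i) :: ('d::finite, 'm) tensor) = det (\<chi> i. l i) ^ CARD('d)"
proof -
  let ?P = "{p. p permutes (UNIV :: 'm set)}"
  have "det (\<chi> i. l i) ^ CARD('d)
      = (\<Prod>j\<in>(UNIV :: 'd set). \<Sum>p\<in>?P. of_int (sign p) * (\<Prod>i\<in>UNIV. l i $ p i))"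
    by (simp add: det_def)
  also have "\<dots> = (\<Sum>\<sigma>\<in>UNIV \<rightarrow>\<^sub>E ?P.
      \<Prod>j\<in>(UNIV :: 'd set). of_int (sign (\<sigma> j)) * (\<Prod>i\<in>UNIV. l i $ \<sigma> j i))"
    by (rule prod_sum_PiE) auto
  also have "\<dots> = (\<Sum>\<sigma> | \<forall>j. \<sigma> j permutes (UNIV :: 'm set).
     (\<Prod>j\<in>(UNIV :: 'd set). of_int (sign (\<sigma> j))) * (\<Prod>i\<in>UNIV. \<Prod>j\<in>UNIV. l i $ \<sigma> j i))"
    by (rule sum.cong) (auto simp: prod.distrib PiE_iff intro: prod.swap)
  finally show ?thesis by (simp add: polar_invariant_def vector_power_def)
qed

lemma polar_invariant_tensor_act:
  fixes v :: "'m::finite \<Rightarrow> ('d::finite, 'm) tensor"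
  assumes "det g = 1" and "\<And>i. v i \<in> sym_forms"
  shows "polar_invariant (\<lambda>i. tensor_act g (v i)) = polar_invariant v"
proof (rule multilinear_eq_on_sym_forms[where I = UNIV and M = "\<lambda>v. polar_invariant (\<lambda>i. tensor_act g (v i))"])
  have upd: "(\<lambda>i. tensor_act g ((v(j := x)) i)) = (\<lambda>i. tensor_act g (v i))(j := tensor_act g x)"
    for v :: "'m \<Rightarrow> ('d, 'm) tensor" and j x
    by auto
  show "multilinear_on UNIV (\<lambda>v :: 'm \<Rightarrow> ('d, 'm) tensor. polar_invariant (\<lambda>i. tensor_act g (v i)))"
    using multilinear_polar_invariant
    unfolding multilinear_on_def upd tensor_act_add tensor_act_smult by blast
next
  fix v :: "'m \<Rightarrow> ('d, 'm) tensor"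
  assume "\<And>i. i \<in> UNIV \<Longrightarrow> v i \<in> range vector_power"
  then have "\<exists>l. \<forall>i. v i = vector_power (l i)" by (intro choice) blast
  then obtain l where v: "v = (\<lambda>i. vector_power (l i))" by auto
  have "(\<chi> i. g *v l i) = (\<chi> i. l i) ** transpose g"
    by (simp add: vec_eq_iff matrix_vector_mult_def matrix_matrix_mult_def transpose_def mult.commute)
  then show "polar_invariant (\<lambda>i. tensor_act g (v i)) = polar_invariant v"
    using assms(1)
    by (simp add: v tensor_act_vector_power polar_invariant_vector_power det_mul det_transpose)
qed (use assms multilinear_polar_invariant in auto)

text \<open>
  Composing every \<open>\<sigma> j\<close> with the same transposition only reorders the factors \<open>w $ (\<lambda>j. \<sigma> j i)\<close>, but
  changes all \<open>D\<close> signs.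
\<close>

lemma generic_invariant_odd:
  fixes w :: "('d::finite, 'm::finite) tensor"
  assumes "odd CARD('d)" and "CARD('m) \<ge> 2"
  shows "generic_invariant w = 0"
proof -
  obtain a b :: 'm where ab: "a \<noteq> b"
    using assms(2) by (metis card_2_iff' ex_card UNIV_I)
  let ?\<Sigma> = "{\<sigma> :: 'd \<Rightarrow> 'm \<Rightarrow> 'm. \<forall>j. \<sigma> j permutes UNIV}"
  let ?F = "\<lambda>\<sigma> :: 'd \<Rightarrow> 'm \<Rightarrow> 'm. (\<Prod>j\<in>UNIV. of_int (sign (\<sigma> j))) * (\<Prod>i\<in>UNIV. w $ (\<lambda>j. \<sigma> j i))"
  have t: "Transposition.transpose a b permutes UNIV" by (simp add: permutes_swap_id)
  have inv: "Transposition.transpose a b \<circ> Transposition.transpose a b = id" by simp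
  have "sum ?F ?\<Sigma> = (\<Sum>\<sigma>\<in>?\<Sigma>. ?F (\<lambda>j. \<sigma> j \<circ> Transposition.transpose a b))"
    by (rule sum.reindex_bij_witness[where i = "\<lambda>\<sigma> j. \<sigma> j \<circ> Transposition.transpose a b"
          and j = "\<lambda>\<sigma> j. \<sigma> j \<circ> Transposition.transpose a b"])
      (auto simp: o_assoc[symmetric] intro: permutes_compose[OF t])
  also have "\<dots> = (\<Sum>\<sigma>\<in>?\<Sigma>. - ?F \<sigma>)"
  proof (rule sum.cong[OF refl])
    fix \<sigma> assume "\<sigma> \<in> ?\<Sigma>"
    then have \<sigma>: "\<sigma> j permutes UNIV" for j by simp
    have "sign (\<sigma> j \<circ> Transposition.transpose a b) = - sign (\<sigma> j)" for j
      using \<sigma>[of j] t ab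
      by (subst sign_compose) (auto simp: permutation_permutes sign_swap_id)
    moreover have "(\<Prod>i\<in>UNIV. w $ (\<lambda>j. (\<sigma> j \<circ> Transposition.transpose a b) i)) = (\<Prod>i\<in>UNIV. w $ (\<lambda>j. \<sigma> j i))"
      using prod.permute[OF t, of "\<lambda>i. w $ (\<lambda>j. \<sigma> j i)"] by (simp add: o_def)
    ultimately show "?F (\<lambda>j. \<sigma> j \<circ> Transposition.transpose a b) = - ?F \<sigma>"
      using assms(1) by (simp add: prod_uminus)
  qed
  also have "\<dots> = - sum ?F ?\<Sigma>" by (rule sum_negf)
  finally show ?thesis by (simp add: generic_invariant_def)
qed

section \<open>Invariant multilinear forms\<close>

lemma det_mat: "det (mat c :: complex^'m::finite^'m) = c ^ CARD('m)"
  by (subst det_diagonal) (auto simp: mat_def)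

lemma det_scalar_factor:
  fixes g :: "complex^'m::finite^'m"
  assumes "det g = t ^ CARD('m)" and "t \<noteq> 0"
  obtains h where "det h = 1" "g = mat t ** h"
proof (rule that)
  show "det (mat (1 / t) ** g) = 1"
    using assms by (simp add: det_mul det_mat power_divide)
  have "mat t ** mat (1 / t) = (mat 1 :: complex^'m^'m)"
    using \<open>t \<noteq> 0\<close>
    by (simp add: matrix_matrix_mult_def mat_def vec_eq_iff if_distrib[of "\<lambda>x. x * _"] cong: if_cong)
  then show "g = mat t ** (mat (1 / t) ** g)"
    by (simp add: matrix_mul_assoc)
qed

definition sl_invariant_form ::
  "(nat \<times> (nat \<Rightarrow> 'd::finite \<Rightarrow> 'm::finite) \<Rightarrow> complex) \<Rightarrow> nat \<Rightarrow> bool" where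
  "sl_invariant_form u d \<longleftrightarrow> (\<forall>g. det g = 1 \<longrightarrow>
     (\<forall>v :: nat \<Rightarrow> ('d, 'm) tensor. multi_form u d (\<lambda>i. tensor_act g (v i)) = multi_form u d v))"

text \<open>
  An \<open>SL\<close>-invariant form transforms under \<open>g\<close> as under the scalar \<open>t\<close>, because \<open>g / t\<close> has
  determinant \<open>1\<close>.
\<close>

lemma multi_form_GL_act:
  fixes v :: "nat \<Rightarrow> ('d::finite, 'm::finite) tensor"
  assumes "sl_invariant_form u d" and "det g = t ^ CARD('m)" and "t \<noteq> 0"
  shows "multi_form u d (\<lambda>i. tensor_act g (v i)) = t ^ (CARD('d) * d) * multi_form u d v"
proof -
  obtain h where h: "det h = 1" "g = mat t ** h"
    using det_scalar_factor[OF assms(2,3)] .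
  have "tensor_act g (v i) = t ^ CARD('d) *s tensor_act h (v i)" for i
    by (simp add: h(2) tensor_act_mat flip: tensor_act_mult)
  then show ?thesis
    using assms(1) h(1) by (simp add: multi_form_smult sl_invariant_form_def power_mult)
qed

text \<open>
  The rank one perturbation \<open>l \<mapsto> l + ((\<Sum>j. y $ j * l $ j) / y $ k) *s axis k 1\<close> of the identity, where
  \<open>y $ k \<noteq> 0\<close>. It differs from the identity matrix in the \<open>k\<close>-th row only.
\<close>

lemma exists_det_two_fixing_hyperplane:
  fixes y :: "complex^'m::finite"
  assumes "y \<noteq> 0"
  obtains g :: "complex^'m^'m" where "det g = 2" "\<And>l. (\<Sum>k\<in>UNIV. y $ k * l $ k) = 0 \<Longrightarrow> g *v l = l"
proof -
  obtain k where k: "y $ k \<noteq> 0" using assms by (auto simp: vec_eq_iff)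
  define x :: "complex^'m" where "x = axis k 1 + (1 / y $ k) *s y"
  define B :: "complex^'m^'m" where "B = (\<chi> i j. if j = k then x $ i else mat 1 $ i $ j)"
  have "det B = x $ k * det (mat 1 :: complex^'m^'m)"
    using cramer_lemma[where x = x and k = k and A = "mat 1 :: complex^'m^'m"]
    by (simp only: B_def matrix_vector_mul_lid)
  then have "det (transpose B) = 2" using k by (simp add: x_def det_transpose)
  moreover have "transpose B *v l = l" if "(\<Sum>j\<in>UNIV. y $ j * l $ j) = 0" for l
  proof -
    have "(transpose B *v l) $ i = l $ i" for i
    proof (cases "i = k")
      case True
      have "(transpose B *v l) $ k = (\<Sum>j\<in>UNIV. x $ j * l $ j)"
        by (simp add: matrix_vector_mult_def transpose_def B_def)
      also have "\<dots> = l $ k + (1 / y $ k) * (\<Sum>j\<in>UNIV. y $ j * l $ j)"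
        by (simp add: x_def distrib_right sum.distrib axis_def sum_distrib_left
            if_distrib[of "\<lambda>x. x * _"] cong: if_cong)
      finally show ?thesis using True that by simp
    next
      case False
      then show ?thesis
        by (simp add: matrix_vector_mult_def transpose_def B_def mat_def
            if_distrib[of "\<lambda>x. x * _"] cong: if_cong)
    qed
    then show ?thesis by (simp add: vec_eq_iff)
  qed
  ultimately show thesis by (rule that)
qed

text \<open>
  If the vectors \<open>l i\<close> lie in a hyperplane, some \<open>g\<close> with determinant \<open>2\<close> fixes them all, so the value
  of the form equals \<open>t ^ (D * d)\<close> times itself for a \<open>t\<close> with \<open>t ^ m = 2\<close>; and this factor is not \<open>1\<close>.
  The hyperplane is given through a singular matrix whose rows include all \<open>l i\<close>, so that the
  lemma serves for fewer than \<open>m\<close> vectors and for \<open>m\<close> dependent ones.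
\<close>

lemma multi_form_vector_power_dependent:
  fixes u :: "nat \<times> (nat \<Rightarrow> 'd::finite \<Rightarrow> 'm::finite) \<Rightarrow> complex" and A :: "complex^'m^'m"
  assumes u: "sl_invariant_form u d" and "d > 0"
    and A: "det A = 0" and l: "\<And>i. i < d \<Longrightarrow> \<exists>k. A $ k = l i"
  shows "multi_form u d (\<lambda>i. vector_power (l i)) = 0"
proof (rule ccontr)
  let ?M = "multi_form u d (\<lambda>i. vector_power (l i))"
  assume "?M \<noteq> 0"
  have "\<not> (\<exists>B. B ** A = mat 1)"
    using A by (simp add: invertible_det_nz flip: invertible_left_inverse)
  then obtain y where y: "A *v y = 0" "y \<noteq> 0"
    unfolding matrix_left_invertible_ker by blast
  obtain g :: "complex^'m^'m" where g: "det g = 2"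
    and fixes_l: "\<And>l. (\<Sum>k\<in>UNIV. y $ k * l $ k) = 0 \<Longrightarrow> g *v l = l"
    using exists_det_two_fixing_hyperplane[OF y(2)] by blast
  have "g *v l i = l i" if i: "i < d" for i
  proof (rule fixes_l)
    obtain k where "A $ k = l i" using l[OF i] ..
    moreover have "(A *v y) $ k = 0" using y by simp
    ultimately show "(\<Sum>k\<in>UNIV. y $ k * l i $ k) = 0"
      by (simp add: matrix_vector_mult_def mult.commute)
  qed
  then have fixed: "multi_form u d (\<lambda>i. tensor_act g (vector_power (l i))) = ?M"
    by (intro multi_form_cong) (simp add: tensor_act_vector_power)
  obtain t :: complex where t: "2 = t ^ CARD('m)" "t \<noteq> 0"
    using exists_complex_root_nonzero[of 2 "CARD('m)"] by auto
  have "t ^ (CARD('d) * d) = 1"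
    using multi_form_GL_act[OF u, of g t "\<lambda>i. vector_power (l i)"] fixed g t \<open>?M \<noteq> 0\<close> by simp
  then have "(t ^ CARD('m)) ^ (CARD('d) * d) = 1"
    by (metis power_commutes power_mult mult.commute power_one)
  then have "(2 :: complex) ^ (CARD('d) * d) = 1" by (simp flip: t(1))
  then have "(2 :: nat) ^ (CARD('d) * d) = 1"
    by (metis of_nat_1 of_nat_eq_iff of_nat_numeral of_nat_power)
  then show False using \<open>d > 0\<close> by simp
qed

text \<open>
  Fewer than \<open>m\<close> vectors never span, so an invariant form of degree below \<open>m\<close> vanishes on powers.
\<close>

lemma invariant_form_degree_ge:
  fixes u :: "nat \<times> (nat \<Rightarrow> 'd::finite \<Rightarrow> 'm::finite) \<Rightarrow> complex"
  assumes u: "sl_invariant_form u d" and d: "0 < d" "d < CARD('m)" and w: "w \<in> sym_forms"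
  shows "multi_form u d (\<lambda>_. w) = 0"
proof -
  have "multi_form u d (\<lambda>_. w) = (\<lambda>_. 0) (\<lambda>_ :: nat. w)"
  proof (rule multilinear_eq_on_sym_forms[where I = "{..<d}"])
    fix v :: "nat \<Rightarrow> ('d, 'm) tensor"
    assume "\<And>i. i \<in> {..<d} \<Longrightarrow> v i \<in> range vector_power"
    then have "\<forall>i. \<exists>l. i < d \<longrightarrow> v i = vector_power l" by blast
    then obtain l where l: "\<And>i. i < d \<Longrightarrow> v i = vector_power (l i)" by metis
    obtain b where b: "bij_betw b {..<CARD('m)} (UNIV :: 'm set)"
      using ex_bij_betw_nat_finite[of "UNIV :: 'm set"] by (auto simp: atLeast0LessThan)
    define c where "c = inv_into {..<CARD('m)} b"
    have c: "c (b i) = i" if "i < CARD('m)" for i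
      using b that by (simp add: c_def bij_betw_inv_into_left)
    \<comment> \<open>The vectors \<open>l i\<close> padded with zero rows; row \<open>b d\<close> is one of the latter.\<close>
    define A :: "complex^'m^'m" where "A = (\<chi> k. if c k < d then l (c k) else 0)"
    have "row (b d) A = 0"
      using c[OF d(2)] by (simp add: A_def row_def vec_eq_iff)
    then have "det A = 0" by (rule det_zero_row)
    moreover have "A $ b i = l i" if "i < d" for i
      using c[of i] that d by (simp add: A_def)
    ultimately have "multi_form u d (\<lambda>i. vector_power (l i)) = 0"
      using multi_form_vector_power_dependent[OF u d(1)] by blast
    moreover have "multi_form u d v = multi_form u d (\<lambda>i. vector_power (l i))"
      using l by (rule multi_form_cong)
    ultimately show "multi_form u d v = 0" by simp
  qed (use w in \<open>auto simp: multilinear_multi_form\<close>, simp add: multilinear_on_def)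
  then show ?thesis by simp
qed

text \<open>
  For \<open>d = m\<close> the matrix with columns \<open>l i\<close> carries the basis powers to the given ones, so on powers an
  invariant form is \<open>det ^ D\<close> times its value \<open>c\<close> at the basis powers. The polarised generic invariant
  equals \<open>det ^ D\<close> there, so the two agree up to the factor \<open>c\<close> on all symmetric tensors.
\<close>

lemma invariant_form_degree_eq:
  fixes u :: "nat \<times> (nat \<Rightarrow> 'd::finite \<Rightarrow> 'm::finite) \<Rightarrow> complex"
  assumes u: "sl_invariant_form u CARD('m)"
  obtains c where "\<And>w. w \<in> sym_forms \<Longrightarrow> multi_form u CARD('m) (\<lambda>_. w) = c * generic_invariant w"
proof -
  obtain b where b: "bij_betw b {..<CARD('m)} (UNIV :: 'm set)"
    using ex_bij_betw_nat_finite[of "UNIV :: 'm set"] by (auto simp: atLeast0LessThan)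
  define c where "c = multi_form u CARD('m) (\<lambda>i. vector_power (axis (b i) 1))"
  have "multi_form u CARD('m) (\<lambda>_. w) = c * generic_invariant w" if w: "w \<in> sym_forms" for w
  proof -
    have "multi_form u CARD('m) (\<lambda>i. v (b i)) = c * polar_invariant v"
      if "\<And>i. v i \<in> sym_forms" for v :: "'m \<Rightarrow> ('d, 'm) tensor"
    proof (rule multilinear_eq_on_sym_forms[where I = UNIV and M = "\<lambda>v. multi_form u CARD('m) (\<lambda>i. v (b i))"])
      show "multilinear_on UNIV (\<lambda>v. multi_form u CARD('m) (\<lambda>i. v (b i)))"
        by (rule multilinear_reindex[OF multilinear_multi_form b multi_form_cong])
      show "multilinear_on UNIV (\<lambda>v :: 'm \<Rightarrow> ('d, 'm) tensor. c * polar_invariant v)"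
        by (rule multilinear_scale[OF multilinear_polar_invariant])
      fix v :: "'m \<Rightarrow> ('d, 'm) tensor"
      assume "\<And>i. i \<in> UNIV \<Longrightarrow> v i \<in> range vector_power"
      then have "\<exists>l. \<forall>i. v i = vector_power (l i)" by (intro choice) blast
      then obtain l where v: "v = (\<lambda>i. vector_power (l i))" by auto
      define A :: "complex^'m^'m" where "A = (\<chi> i. l i)"
      show "multi_form u CARD('m) (\<lambda>i. v (b i)) = c * polar_invariant v"
      proof (cases "det A = 0")
        case True
        have "multi_form u CARD('m) (\<lambda>i. vector_power (l (b i))) = 0"
          by (rule multi_form_vector_power_dependent[OF u _ True]) (auto simp: A_def)
        then show ?thesis using True by (simp add: v polar_invariant_vector_power A_def)
      next
        case False
        obtain t where t: "det A = t ^ CARD('m)" "t \<noteq> 0"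
          using exists_complex_root_nonzero[OF False, of "CARD('m)"] by auto
        have "transpose A *v axis k 1 = l k" for k
          by (simp add: matrix_vector_mult_def transpose_def A_def axis_def vec_eq_iff
              if_distrib[of "\<lambda>x. _ * x"] cong: if_cong)
        then have "multi_form u CARD('m) (\<lambda>i. v (b i))
            = multi_form u CARD('m) (\<lambda>i. tensor_act (transpose A) (vector_power (axis (b i) 1)))"
          by (simp add: v tensor_act_vector_power)
        also have "\<dots> = t ^ (CARD('d) * CARD('m)) * c"
          unfolding c_def by (rule multi_form_GL_act[OF u]) (use t in \<open>auto simp: det_transpose\<close>)
        also have "t ^ (CARD('d) * CARD('m)) = det A ^ CARD('d)"
          by (simp add: t(1) mult.commute flip: power_mult)
        finally show ?thesis by (simp add: v polar_invariant_vector_power A_def)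
      qed
    qed (use that in auto)
    from this[of "\<lambda>_. w"] w show ?thesis by (simp add: generic_invariant_eq_polar)
  qed
  then show thesis by (rule that)
qed

section \<open>Orbit closures\<close>

lemma mem_zariski_closure_iff:
  "v \<in> zariski_closure X \<longleftrightarrow>
    (\<forall>p. complex_polynomial_function p \<longrightarrow> (\<forall>x\<in>X. p x = 0) \<longrightarrow> p v = 0)"
proof (intro iffI allI impI)
  fix p
  assume v: "v \<in> zariski_closure X" and p: "complex_polynomial_function p" "\<forall>x\<in>X. p x = 0"
  have "zariski_closed {x. p x = 0}"
    unfolding zariski_closed_def using p(1) by (intro exI[of _ "{p}"]) auto
  then have "zariski_closed hull X \<subseteq> {x. p x = 0}"
    using p(2) by (intro hull_minimal) auto
  with v show "p v = 0" by (auto simp: zariski_closure_def)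
next
  assume v: "\<forall>p. complex_polynomial_function p \<longrightarrow> (\<forall>x\<in>X. p x = 0) \<longrightarrow> p v = 0"
  show "v \<in> zariski_closure X"
    unfolding zariski_closure_def hull_def
  proof (intro InterI)
    fix T assume T: "T \<in> {T. zariski_closed T \<and> X \<subseteq> T}"
    then obtain F where "\<forall>p\<in>F. complex_polynomial_function p" "T = {x. \<forall>p\<in>F. p x = 0}"
      unfolding zariski_closed_def by blast
    with v T show "v \<in> T" by auto
  qed
qed

lemma polynomial_smult_comp:
  assumes "complex_polynomial_function p"
  shows "complex_polynomial_function (\<lambda>x. p (c *s x))"
  using assms by induction (auto intro: complex_polynomial_function.intros)

lemma SL_iff: "g \<in> SL \<longleftrightarrow> det g = 1"
  by (simp add: SL_def)

lemma GL_iff: "(g :: complex^'m^'m) \<in> GL \<longleftrightarrow> det g \<noteq> 0"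
  by (simp add: GL_def invertible_det_nz)

lemma tensor_act_one: "tensor_act (mat 1) v = v"
  by (simp add: tensor_act_mat)

lemma orbit_subset_closure: "g \<in> GL \<Longrightarrow> tensor_act g w \<in> orbit_closure w"
  by (auto simp: orbit_closure_def zariski_closure_def orbit_def intro: hull_inc)

lemma self_in_closure: "w \<in> orbit_closure w"
  using orbit_subset_closure[of "mat 1" w] by (simp add: GL_iff tensor_act_one)

lemma closure_vanish:
  assumes "v \<in> orbit_closure w" and "complex_polynomial_function p"
    and "\<And>g. g \<in> GL \<Longrightarrow> p (tensor_act g w) = 0"
  shows "p v = 0"
  using assms unfolding orbit_closure_def mem_zariski_closure_iff orbit_def by auto

lemma closure_tensor_act:
  assumes "v \<in> orbit_closure w" and "g \<in> GL"
  shows "tensor_act g v \<in> orbit_closure w"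
  unfolding orbit_closure_def mem_zariski_closure_iff
proof (intro allI impI)
  fix p :: "('a, 'b) tensor \<Rightarrow> complex"
  assume p: "complex_polynomial_function p" "\<forall>x\<in>orbit GL w. p x = 0"
  show "p (tensor_act g v) = 0"
  proof (rule closure_vanish[OF assms(1)])
    show "complex_polynomial_function (\<lambda>v. p (tensor_act g v))"
      unfolding tensor_act_eq by (rule polynomial_linear_comp[OF p(1)])
    show "p (tensor_act g (tensor_act h w)) = 0" if "h \<in> GL" for h
      using p(2) that assms(2) by (auto simp: tensor_act_mult orbit_def GL_iff det_mul)
  qed
qed

lemma closure_SL_act:
  "v \<in> orbit_closure w \<Longrightarrow> det g = 1 \<Longrightarrow> tensor_act g v \<in> orbit_closure w"
  by (rule closure_tensor_act) (simp_all add: GL_iff)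

text \<open>
  For \<open>c \<noteq> 0\<close> the scalar comes from a scalar matrix, as \<open>c\<close> has a \<open>D\<close>-th root. For \<open>c = 0\<close> a polynomial that
  vanishes on all nonzero multiples of a point vanishes at the origin by continuity.
\<close>

lemma closure_smult:
  fixes w :: "('d::finite, 'm::finite) tensor"
  assumes "v \<in> orbit_closure w"
  shows "c *s v \<in> orbit_closure w"
  unfolding orbit_closure_def mem_zariski_closure_iff
proof (intro allI impI)
  fix p :: "('d, 'm) tensor \<Rightarrow> complex"
  assume p: "complex_polynomial_function p" "\<forall>x\<in>orbit GL w. p x = 0"
  show "p (c *s v) = 0"
  proof (rule closure_vanish[OF assms polynomial_smult_comp[OF p(1)]])
    fix g :: "complex^'m^'m"
    assume g: "g \<in> GL"
    have nonzero: "p (b *s tensor_act g w) = 0" if b: "b \<noteq> 0" for b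
    proof -
      obtain t where t: "t \<noteq> 0" "b = t ^ CARD('d)"
        using exists_complex_root_nonzero[OF b, of "CARD('d)"] by auto
      have "tensor_act (mat t ** g) w \<in> orbit GL w"
        using g t by (auto simp: orbit_def GL_iff det_mul det_mat)
      with p(2) show ?thesis
        by (simp add: t(2) tensor_act_mat flip: tensor_act_mult)
    qed
    show "p (c *s tensor_act g w) = 0"
    proof (cases "c = 0")
      case True
      have "isCont (\<lambda>b. p (b *s tensor_act g w)) 0"
        using p(1) by induction (auto intro!: continuous_intros)
      then have "(\<lambda>b. p (b *s tensor_act g w)) \<midarrow>0\<rightarrow> p (0 *s tensor_act g w)"
        by (simp add: isCont_def)
      moreover have "(\<lambda>b. p (b *s tensor_act g w)) \<midarrow>0\<rightarrow> 0"
        by (rule tendsto_eventually) (auto simp: eventually_at_filter nonzero)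
      ultimately show ?thesis unfolding True by (rule LIM_unique)
    qed (rule nonzero)
  qed
qed

lemma sym_forms_tensor_act:
  fixes w :: "('d::finite, 'm::finite) tensor"
  assumes w: "w \<in> sym_forms"
  shows "tensor_act g w \<in> sym_forms"
  unfolding sym_forms_def
proof (intro CollectI allI impI)
  fix \<pi> :: "'d \<Rightarrow> 'd" and \<nu> :: "'d \<Rightarrow> 'm"
  assume \<pi>: "\<pi> permutes UNIV"
  have "(\<Sum>\<kappa>\<in>UNIV. (\<Prod>j\<in>UNIV. g $ \<nu> (\<pi> j) $ \<kappa> j) * w $ \<kappa>)
      = (\<Sum>\<kappa>\<in>UNIV. (\<Prod>j\<in>UNIV. g $ \<nu> (\<pi> j) $ \<kappa> (\<pi> j)) * w $ (\<kappa> \<circ> \<pi>))"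
    by (rule sum.reindex_bij_witness[where i = "\<lambda>\<kappa>. \<kappa> \<circ> \<pi>" and j = "\<lambda>\<kappa>. \<kappa> \<circ> inv \<pi>"])
      (auto simp: o_assoc[symmetric] permutes_inv_o[OF \<pi>] permutes_inverses[OF \<pi>])
  also have "\<dots> = (\<Sum>\<kappa>\<in>UNIV. (\<Prod>j\<in>UNIV. g $ \<nu> j $ \<kappa> j) * w $ \<kappa>)"
    using w \<pi> prod.permute[OF \<pi>, of "\<lambda>j. g $ \<nu> j $ _ j"]
    by (intro sum.cong refl) (simp add: sym_forms_def o_def)
  finally show "tensor_act g w $ (\<nu> \<circ> \<pi>) = tensor_act g w $ \<nu>"
    by (simp add: tensor_act_def)
qed

lemma orbit_closure_subset_sym_forms:
  fixes w :: "('d::finite, 'm::finite) tensor"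
  assumes "w \<in> sym_forms"
  shows "orbit_closure w \<subseteq> sym_forms"
proof
  fix v assume v: "v \<in> orbit_closure w"
  have "v $ (\<nu> \<circ> \<pi>) - v $ \<nu> = 0" if "\<pi> permutes UNIV" for \<pi> \<nu>
  proof (rule closure_vanish[OF v])
    show "complex_polynomial_function (\<lambda>v :: ('d, 'm) tensor. v $ (\<nu> \<circ> \<pi>) - v $ \<nu>)"
      by (intro polynomial_diff complex_polynomial_function.intros)
    show "tensor_act g w $ (\<nu> \<circ> \<pi>) - tensor_act g w $ \<nu> = 0" for g
      using sym_forms_tensor_act[OF assms, of g] that by (simp add: sym_forms_def)
  qed
  then show "v \<in> sym_forms" by (simp add: sym_forms_def)
qed

section \<open>Extending invariants from stable sets\<close>

text \<open>
  The Reynolds operator in the form used here: a polynomial that is invariant on an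
  \<open>SL\<close>-stable set \<open>X\<close> agrees there with an invariant of the whole tensor space, each
  homogeneous part of which is invariant even as a multilinear form. The stable
  subspace to project along consists of the coefficients of polynomials that vanish on \<open>X\<close>.
\<close>

lemma invariant_polynomial_extension:
  fixes X :: "('d::finite, 'm::finite) tensor set"
  assumes p: "complex_polynomial_function p"
    and X: "\<And>g x. det g = 1 \<Longrightarrow> x \<in> X \<Longrightarrow> tensor_act g x \<in> X"
    and inv: "\<And>g x. det g = 1 \<Longrightarrow> x \<in> X \<Longrightarrow> p (tensor_act g x) = p x"
  obtains u N where "\<And>d. sl_invariant_form u d" "\<And>x. x \<in> X \<Longrightarrow> p x = (\<Sum>d\<le>N. multi_form u d (\<lambda>_. x))"
proof -
  obtain a N where a: "p = (\<lambda>x. \<Sum>d\<le>N. multi_form a d (\<lambda>_. x))"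
    using polynomial_expansion[OF p] .
  define K where "K = {k. \<forall>x\<in>X. (\<Sum>d\<le>N. multi_form k d (\<lambda>_. x)) = 0}"
  define \<Gamma> :: "(nat \<times> (nat \<Rightarrow> 'd \<Rightarrow> 'm) \<Rightarrow> nat \<times> (nat \<Rightarrow> 'd \<Rightarrow> 'm) \<Rightarrow> complex) set"
    where "\<Gamma> = {tensor_power_kernel (tensor_matrix g) |g. det g = 1}"
  have act: "(\<Sum>d\<le>N. multi_form (apply_kernel (indices N) (tensor_power_kernel (tensor_matrix g)) k) d (\<lambda>_. x))
      = (\<Sum>d\<le>N. multi_form k d (\<lambda>_. tensor_act g x))" for g k and x :: "('d, 'm) tensor"
    by (intro sum.cong) (auto simp: multi_form_apply_kernel tensor_act_eq)
  obtain u0 where u0: "(\<lambda>s. a s - u0 s) \<in> K"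
    and fixed: "\<And>T s. T \<in> \<Gamma> \<Longrightarrow> s \<in> indices N \<Longrightarrow> apply_kernel (indices N) T u0 s = u0 s"
  proof (rule invariant_representative[of "indices N" K \<Gamma> a])
    show "finite (indices N :: (nat \<times> (nat \<Rightarrow> 'd \<Rightarrow> 'm)) set)" by (rule finite_indices)
    show "(\<lambda>x y. cnj (T y x)) \<in> \<Gamma>" if T: "T \<in> \<Gamma>" for T
    proof -
      obtain g where g: "T = tensor_power_kernel (tensor_matrix g)" "det g = 1" using T by (auto simp: \<Gamma>_def)
      then have "(\<lambda>x y. cnj (T y x)) = tensor_power_kernel (tensor_matrix (adjoint_mat g))" "det (adjoint_mat g) = 1"
        by (simp_all add: tensor_power_kernel_adjoint tensor_matrix_adjoint det_adjoint_mat)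
      then show ?thesis unfolding \<Gamma>_def by blast
    qed
    show "apply_kernel (indices N) T k \<in> K" if "T \<in> \<Gamma>" "k \<in> K" for T k
      using that X by (auto simp: \<Gamma>_def K_def act)
    show "(\<lambda>s. apply_kernel (indices N) T a s - a s) \<in> K" if "T \<in> \<Gamma>" for T
      using that inv by (auto simp: \<Gamma>_def K_def multi_form_diff sum_subtractf act a)
  qed (auto simp: K_def multi_form_zero multi_form_add multi_form_scale sum.distrib simp flip: sum_distrib_left)
  define u where "u = (\<lambda>y. if fst y \<le> N then u0 y else 0)"
  have u_low: "multi_form u d v = multi_form u0 d v" if "d \<le> N" for d v
    using that by (simp add: u_def multi_form_def)
  have "sl_invariant_form u d" for d
  proof (cases "d \<le> N")
    case True
    have "multi_form u0 d (\<lambda>i. tensor_act g (v i)) = multi_form u0 d v"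
      if "det g = 1" for g and v :: "nat \<Rightarrow> ('d, 'm) tensor"
    proof -
      have "multi_form u0 d (\<lambda>i. tensor_act g (v i))
          = multi_form (apply_kernel (indices N) (tensor_power_kernel (tensor_matrix g)) u0) d v"
        using True by (simp add: multi_form_apply_kernel tensor_act_eq)
      also have "\<dots> = multi_form u0 d v"
        unfolding multi_form_def
        using that True by (intro sum.cong refl) (subst fixed, auto simp: \<Gamma>_def indices_def)
      finally show ?thesis .
    qed
    then show ?thesis by (simp add: sl_invariant_form_def u_low[OF True])
  next
    case False
    then show ?thesis by (simp add: sl_invariant_form_def u_def multi_form_def)
  qed
  moreover have "p x = (\<Sum>d\<le>N. multi_form u d (\<lambda>_. x))" if "x \<in> X" for x
    using u0 that by (simp add: K_def a multi_form_diff sum_subtractf u_low)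
  ultimately show thesis by (rule that)
qed

text \<open>
  The orbit of a nonzero tensor misses the origin and is closed, so some polynomial vanishes on it but
  not at \<open>0\<close>. This polynomial is invariant on the orbit together with \<open>0\<close>, hence can be replaced by an
  invariant one. As that one is nonzero at \<open>0\<close> and zero at \<open>w\<close>, its nonconstant part is nonzero at \<open>w\<close>.
\<close>

lemma polystable_nonvanishing_form:
  fixes w :: "('d::finite, 'm::finite) tensor"
  assumes "w \<noteq> 0" and "polystable w"
  obtains u d where "sl_invariant_form u d" "d > 0" "multi_form u d (\<lambda>_. w) \<noteq> 0"
proof -
  obtain F where F: "\<And>p. p \<in> F \<Longrightarrow> complex_polynomial_function p"
    "orbit SL w = {x. \<forall>p\<in>F. p x = 0}"
    using assms(2) unfolding polystable_def zariski_closed_def by blast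
  have "0 \<notin> orbit SL w"
  proof
    assume "0 \<in> orbit SL w"
    then obtain g where g: "det g = 1" "tensor_act g w = 0" by (auto simp: orbit_def SL_iff)
    then obtain h where "h ** g = mat 1"
      using invertible_det_nz[of g] invertible_left_inverse[of g] by auto
    then have "tensor_act h (tensor_act g w) = w" by (simp add: tensor_act_mult tensor_act_one)
    with g(2) \<open>w \<noteq> 0\<close> show False by (simp add: tensor_act_eq)
  qed
  then obtain p where p: "p \<in> F" "p 0 \<noteq> 0" using F(2) by auto
  have p_orbit: "p x = 0" if "x \<in> orbit SL w" for x
    using that p(1) F(2) by auto
  have stable: "tensor_act g x \<in> orbit SL w" if "det g = 1" "x \<in> orbit SL w" for g x
    using that by (auto simp: orbit_def SL_iff tensor_act_mult det_mul)
  have zero: "tensor_act g 0 = (0 :: ('d, 'm) tensor)" for g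
    by (simp add: tensor_act_eq)
  obtain u N where u: "\<And>d. sl_invariant_form u d"
    and pu: "\<And>x. x \<in> insert 0 (orbit SL w) \<Longrightarrow> p x = (\<Sum>d\<le>N. multi_form u d (\<lambda>_. x))"
    by (rule invariant_polynomial_extension[OF F(1)[OF p(1)], of "insert 0 (orbit SL w)"])
      (use stable p_orbit zero in auto)
  have w: "w \<in> orbit SL w"
    unfolding orbit_def by (intro image_eqI[of _ _ "mat 1"]) (auto simp: SL_iff tensor_act_one)
  have split: "(\<Sum>d\<le>N. multi_form u d (\<lambda>_. x)) = u (0, \<lambda>_. undefined) + (\<Sum>d\<in>{1..N}. multi_form u d (\<lambda>_. x))"
    for x :: "('d, 'm) tensor"
  proof -
    have "{..N} = insert 0 {1..N}" by auto
    then show ?thesis by (simp add: multi_form_degree_zero)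
  qed
  have "p 0 = u (0, \<lambda>_. undefined)"
    using pu[of 0] by (simp add: split multi_form_at_zero)
  moreover have "p w = 0" using p_orbit w .
  ultimately have "(\<Sum>d\<in>{1..N}. multi_form u d (\<lambda>_. w)) \<noteq> 0"
    using pu[of w] w p(2) split[of w] by auto
  then obtain d where "d \<in> {1..N}" "multi_form u d (\<lambda>_. w) \<noteq> 0"
    by (meson sum.neutral)
  then show thesis using u by (intro that[of u d]) auto
qed

lemma SL_invariants_iff:
  "f \<in> SL_invariants w d \<longleftrightarrow> (\<exists>p. complex_polynomial_function p \<and> f = restrict p (orbit_closure w) \<and>
     (\<forall>g. det g = 1 \<longrightarrow> (\<forall>v\<in>orbit_closure w. p (tensor_act g v) = p v)) \<and>
     (\<forall>c. \<forall>v\<in>orbit_closure w. p (c *s v) = c ^ d * p v))"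
  (is "?l \<longleftrightarrow> ?r")
proof
  assume ?l
  then obtain p where "complex_polynomial_function p" "f = restrict p (orbit_closure w)"
      "\<And>g v. det g = 1 \<Longrightarrow> v \<in> orbit_closure w \<Longrightarrow> f (tensor_act g v) = f v"
      "\<And>c v. v \<in> orbit_closure w \<Longrightarrow> f (c *s v) = c ^ d * f v"
    by (auto simp: SL_invariants_def regular_functions_def SL_iff)
  then show ?r by (intro exI[of _ p]) (simp add: closure_SL_act closure_smult)
next
  assume ?r
  then show ?l
    by (auto simp: SL_invariants_def regular_functions_def SL_iff closure_SL_act closure_smult)
qed

text \<open>
  \<open>GL\<close> is generated by \<open>SL\<close> and the scalars, so on the orbit a homogeneous invariant is
  determined by its value at \<open>w\<close>, and the orbit is dense in its closure.
\<close>

lemma invariant_zero_if_zero_at: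
  fixes w :: "('d::finite, 'm::finite) tensor"
  assumes p: "complex_polynomial_function p"
    and inv: "\<And>g v. det g = 1 \<Longrightarrow> v \<in> orbit_closure w \<Longrightarrow> p (tensor_act g v) = p v"
    and hom: "\<And>c v. v \<in> orbit_closure w \<Longrightarrow> p (c *s v) = c ^ d * p v"
    and "p w = 0" and v: "v \<in> orbit_closure w"
  shows "p v = 0"
proof (rule closure_vanish[OF v p])
  fix g :: "complex^'m^'m"
  assume "g \<in> GL"
  then have "det g \<noteq> 0" by (simp add: GL_iff)
  then obtain t where t: "det g = t ^ CARD('m)" "t \<noteq> 0"
    using exists_complex_root_nonzero[of "det g" "CARD('m)"] by auto
  obtain h where h: "det h = 1" "g = mat t ** h" using det_scalar_factor[OF t] .
  have "tensor_act h w \<in> orbit_closure w"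
    using h(1) by (intro orbit_subset_closure) (simp add: GL_iff)
  then have "p (tensor_act g w) = (t ^ CARD('d)) ^ d * p (tensor_act h w)"
    by (simp add: h(2) tensor_act_mat hom flip: tensor_act_mult)
  also have "p (tensor_act h w) = 0" using inv[OF h(1) self_in_closure] \<open>p w = 0\<close> by simp
  finally show "p (tensor_act g w) = 0" by simp
qed

text \<open>
  The extension of \<open>p\<close> to an invariant of the whole space may have parts of several degrees; comparing
  coefficients of \<open>c\<close> along the line of multiples \<open>c *s w\<close> shows that the part of degree \<open>d\<close> takes the
  value \<open>p w\<close>.
\<close>

lemma invariant_value_by_form:
  fixes w :: "('d::finite, 'm::finite) tensor"
  assumes p: "complex_polynomial_function p"
    and inv: "\<And>g v. det g = 1 \<Longrightarrow> v \<in> orbit_closure w \<Longrightarrow> p (tensor_act g v) = p v"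
    and hom: "\<And>c v. v \<in> orbit_closure w \<Longrightarrow> p (c *s v) = c ^ d * p v"
    and nz: "p w \<noteq> 0"
  obtains u where "sl_invariant_form u d" "multi_form u d (\<lambda>_. w) = p w"
proof -
  obtain u N where u: "\<And>d. sl_invariant_form u d"
    and pu: "\<And>x. x \<in> orbit_closure w \<Longrightarrow> p x = (\<Sum>d\<le>N. multi_form u d (\<lambda>_. x))"
    by (rule invariant_polynomial_extension[OF p, of "orbit_closure w"])
      (use inv closure_SL_act in auto)
  define M where "M = max N d"
  have "\<forall>c. (\<Sum>e\<le>M. (if e \<le> N then multi_form u e (\<lambda>_. w) else 0) * c ^ e)
      = (\<Sum>e\<le>M. (if e = d then p w else 0) * c ^ e)" (is "\<forall>c. ?l c = ?r c")
  proof
    fix c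
    have "(\<Sum>e\<le>M. (if e \<le> N then multi_form u e (\<lambda>_. w) else 0) * c ^ e)
        = (\<Sum>e\<le>N. multi_form u e (\<lambda>_. w) * c ^ e)"
      by (rule sum.mono_neutral_cong_right) (auto simp: M_def)
    also have "\<dots> = p (c *s w)"
      by (simp add: pu[OF closure_smult[OF self_in_closure]] multi_form_smult mult.commute)
    also have "\<dots> = (\<Sum>e\<le>M. if e = d then p w * c ^ e else 0)"
      by (simp add: hom[OF self_in_closure] M_def mult.commute)
    also have "\<dots> = ?r c" by (rule sum.cong) auto
    finally show "?l c = ?r c" .
  qed
  from iffD1[OF polyfun_eq_coeffs this]
  have "\<forall>e\<le>M. (if e \<le> N then multi_form u e (\<lambda>_. w) else 0) = (if e = d then p w else 0)" .
  then have "(if d \<le> N then multi_form u d (\<lambda>_. w) else 0) = p w" unfolding M_def by simp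
  with nz have "multi_form u d (\<lambda>_. w) = p w" by (simp split: if_splits)
  with u show thesis by (rule that)
qed

lemma form_in_SL_invariants:
  assumes "sl_invariant_form u d"
  shows "restrict (\<lambda>x. multi_form u d (\<lambda>_. x)) (orbit_closure w) \<in> SL_invariants w d"
  unfolding SL_invariants_iff
  using assms by (intro exI[of _ "\<lambda>x. multi_form u d (\<lambda>_. x)"])
    (auto simp: polynomial_multi_form multi_form_smult sl_invariant_form_def)

text \<open>
  The degrees among which \<open>min_degree w\<close> is the least positive one are thereby described
  by invariant multilinear forms.
\<close>

lemma SL_invariants_nonzero_iff:
  "(\<exists>f\<in>SL_invariants w d. \<exists>v\<in>orbit_closure w. f v \<noteq> 0) \<longleftrightarrow>
    (\<exists>u. sl_invariant_form u d \<and> multi_form u d (\<lambda>_. w) \<noteq> 0)"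
proof
  assume "\<exists>f\<in>SL_invariants w d. \<exists>v\<in>orbit_closure w. f v \<noteq> 0"
  then obtain f v where f: "f \<in> SL_invariants w d" and v: "v \<in> orbit_closure w" "f v \<noteq> 0"
    by blast
  from f obtain p where p: "complex_polynomial_function p"
      "\<And>g v. det g = 1 \<Longrightarrow> v \<in> orbit_closure w \<Longrightarrow> p (tensor_act g v) = p v"
      "\<And>c v. v \<in> orbit_closure w \<Longrightarrow> p (c *s v) = c ^ d * p v"
    and "f = restrict p (orbit_closure w)"
    unfolding SL_invariants_iff by blast
  with v have "p v \<noteq> 0" by simp
  have "p w \<noteq> 0"
  proof
    assume "p w = 0"
    from invariant_zero_if_zero_at[OF p this v(1)] \<open>p v \<noteq> 0\<close> show False by simp
  qed
  from invariant_value_by_form[OF p this] obtain u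
    where "sl_invariant_form u d" "multi_form u d (\<lambda>_. w) = p w" .
  with \<open>p w \<noteq> 0\<close> show "\<exists>u. sl_invariant_form u d \<and> multi_form u d (\<lambda>_. w) \<noteq> 0" by auto
next
  assume "\<exists>u. sl_invariant_form u d \<and> multi_form u d (\<lambda>_. w) \<noteq> 0"
  then obtain u where "sl_invariant_form u d" "multi_form u d (\<lambda>_. w) \<noteq> 0" by blast
  then show "\<exists>f\<in>SL_invariants w d. \<exists>v\<in>orbit_closure w. f v \<noteq> 0"
    by (intro bexI[OF _ form_in_SL_invariants] bexI[OF _ self_in_closure])
      (simp_all add: self_in_closure)
qed

text \<open>
  The spaces of invariants are at most one-dimensional, which makes the fundamental invariant unique.
\<close>

lemma SL_invariants_eqI:
  assumes f: "f \<in> SL_invariants w d" and h: "h \<in> SL_invariants w d" and "f w = h w"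
  shows "f = h"
proof -
  obtain p where p: "complex_polynomial_function p" "f = restrict p (orbit_closure w)"
      "\<And>g v. det g = 1 \<Longrightarrow> v \<in> orbit_closure w \<Longrightarrow> p (tensor_act g v) = p v"
      "\<And>c v. v \<in> orbit_closure w \<Longrightarrow> p (c *s v) = c ^ d * p v"
    using f unfolding SL_invariants_iff by blast
  obtain q where q: "complex_polynomial_function q" "h = restrict q (orbit_closure w)"
      "\<And>g v. det g = 1 \<Longrightarrow> v \<in> orbit_closure w \<Longrightarrow> q (tensor_act g v) = q v"
      "\<And>c v. v \<in> orbit_closure w \<Longrightarrow> q (c *s v) = c ^ d * q v"
    using h unfolding SL_invariants_iff by blast
  have "p v - q v = 0" if "v \<in> orbit_closure w" for v
    by (rule invariant_zero_if_zero_at[OF polynomial_diff[OF p(1) q(1)], of w d])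
      (use p q that self_in_closure[of w] \<open>f w = h w\<close> in \<open>auto simp: right_diff_distrib\<close>)
  then show "f = h" by (auto simp: p(2) q(2) restrict_def)
qed

lemma generic_invariant_in_SL_invariants:
  fixes w :: "('d::finite, 'm::finite) tensor"
  assumes w: "w \<in> sym_forms"
  shows "restrict (\<lambda>v. a * generic_invariant v) (orbit_closure w) \<in> SL_invariants w CARD('m)"
  unfolding SL_invariants_iff
proof (intro exI conjI allI impI ballI)
  show "complex_polynomial_function (\<lambda>v :: ('d, 'm) tensor. a * generic_invariant v)"
    unfolding generic_invariant_def
    by (intro complex_polynomial_function.intros polynomial_sum polynomial_prod) auto
  show "a * generic_invariant (tensor_act g v) = a * generic_invariant v"
    if "det g = 1" "v \<in> orbit_closure w" for g v
    using polar_invariant_tensor_act[OF that(1), of "\<lambda>_. v"] that(2)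
      orbit_closure_subset_sym_forms[OF w] by (auto simp: generic_invariant_eq_polar)
  show "a * generic_invariant (c *s v) = c ^ CARD('m) * (a * generic_invariant v)"
    for c and v :: "('d, 'm) tensor"
    by (simp add: generic_invariant_def prod.distrib sum_distrib_left mult_ac)
qed (rule refl)

section \<open>Minimal degree and fundamental invariant\<close>

theorem theorem3p15:
  fixes w :: "('d::finite, 'm::finite) tensor"
  assumes "w \<in> sym_forms" and "w \<noteq> 0" and "polystable w"
  shows "CARD('m) \<le> min_degree w \<and>
    (odd CARD('d) \<and> CARD('m) \<ge> 2 \<longrightarrow> CARD('m) < min_degree w) \<and>
    (even CARD('d) \<longrightarrow>
      (CARD('m) = min_degree w \<longleftrightarrow> generic_invariant w \<noteq> 0) \<and>
      (CARD('m) = min_degree w \<longrightarrow>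
        (\<forall>v\<in>orbit_closure w.
          fundamental_invariant w v = inverse (generic_invariant w) * generic_invariant v)))"
proof -
  define nz where "nz d \<longleftrightarrow> (\<exists>f\<in>SL_invariants w d. \<exists>v\<in>orbit_closure w. f v \<noteq> 0)" for d
  have min: "min_degree w = (LEAST d. d > 0 \<and> nz d)"
    by (simp add: min_degree_def nz_def)
  \<comment> \<open>Without an invariant of positive degree, \<open>LEAST\<close> would be an unspecified number.\<close>
  obtain u0 d0 where "sl_invariant_form u0 d0" "d0 > 0" "multi_form u0 d0 (\<lambda>_. w) \<noteq> 0"
    using polystable_nonvanishing_form[OF assms(2,3)] .
  then have "\<exists>d. d > 0 \<and> nz d" unfolding nz_def SL_invariants_nonzero_iff by blast
  from LeastI_ex[OF this] have pos: "min_degree w > 0" and "nz (min_degree w)"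
    by (simp_all add: min)
  then obtain u where u: "sl_invariant_form u (min_degree w)" "multi_form u (min_degree w) (\<lambda>_. w) \<noteq> 0"
    unfolding nz_def SL_invariants_nonzero_iff by blast
  have ge: "CARD('m) \<le> min_degree w"
    using invariant_form_degree_ge[OF u(1) pos _ assms(1)] u(2) by (meson not_le)
  have nonzero: "generic_invariant w \<noteq> 0" if "CARD('m) = min_degree w"
  proof -
    from u(1) have "sl_invariant_form u CARD('m)" by (simp add: that)
    then obtain c where "multi_form u CARD('m) (\<lambda>_. w) = c * generic_invariant w"
      by (rule invariant_form_degree_eq) (use assms(1) in blast)
    with u(2) that show ?thesis by auto
  qed
  have le: "min_degree w \<le> CARD('m)" if "generic_invariant w \<noteq> 0"
  proof -
    have "restrict (\<lambda>v. 1 * generic_invariant v) (orbit_closure w) w \<noteq> 0"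
      using that self_in_closure[of w] by simp
    then have "nz CARD('m)"
      unfolding nz_def
      using generic_invariant_in_SL_invariants[OF assms(1), of 1] self_in_closure[of w] by blast
    then show ?thesis unfolding min by (intro Least_le) simp
  qed
  have fundamental: "fundamental_invariant w v = inverse (generic_invariant w) * generic_invariant v"
    if eq: "CARD('m) = min_degree w" and v: "v \<in> orbit_closure w" for v
  proof -
    define f where "f = restrict (\<lambda>v. inverse (generic_invariant w) * generic_invariant v) (orbit_closure w)"
    have f: "f \<in> SL_invariants w (min_degree w)" "f w = 1"
      using generic_invariant_in_SL_invariants[OF assms(1)] nonzero[OF eq] self_in_closure[of w]
      by (simp_all add: f_def flip: eq)
    have "fundamental_invariant w = f"
      unfolding fundamental_invariant_def
    proof (rule the_equality)
      fix h assume h: "h \<in> SL_invariants w (min_degree w) \<and> h w = 1"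
      with f show "h = f" by (intro SL_invariants_eqI[of h w "min_degree w" f]) simp_all
    qed (use f in simp)
    then show ?thesis using v by (simp add: f_def)
  qed
  have "CARD('m) < min_degree w" if "odd CARD('d)" "CARD('m) \<ge> 2"
    using generic_invariant_odd[OF that, of w] nonzero ge by (simp add: nat_less_le) blast
  moreover have "CARD('m) = min_degree w \<longleftrightarrow> generic_invariant w \<noteq> 0"
    using nonzero le ge le_antisym by blast
  ultimately show ?thesis using ge fundamental by simp
qed

end
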